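(* Let $\Lambda_1,\Lambda_2$ be single vertex 2-graphs with generating graphs having a single red edge and finitely many blue edges. Then the following statements are equivalent. (1) $\Lambda_1$ and $\Lambda_2$ are isomorphic 2-graphs. (2) $\mathcal A_{\Lambda_1}$ and $\mathcal A_{\Lambda_2}$ are isometrically isomorphic. (3) $\mathcal L_{\Lambda_1}$ and $\mathcal L_{\Lambda_2}$ are unitarily equivalent.
   Context: A single vertex 2-graph $\Lambda$ with $n$ blue edges and one red edge is identified with the unital semigroup generated by $e_1,\dots,e_n$ (blue) and $f$ (red) subject only to the relations $e_if=fe_{\tau(i)}$, $1\le i\le n$, for some permutation $\tau\in S_n$; $n$ may differ for $\Lambda_1$ and $\Lambda_2$. (This semigroup is left and right cancellative.) Two such 2-graphs are isomorphic if these semigroups are isomorphic. The Fock space is the Hilbert space with orthonormal basis $\{\xi_w\}$ indexed by the elements $w$ of the semigroup; $L_v\xi_w=\xi_{vw}$ defines isometries $L_v$. $\mathcal A_\Lambda$ (resp. $\mathcal L_\Lambda$) is the norm closed (resp. weak operator topology closed) operator algebra generated by all the $L_w$. Isometrically isomorphic means that there is an isometric algebra isomorphism; unitarily equivalent means $U\mathcal L_{\Lambda_1}U^*=\mathcal L_{\Lambda_2}$ for some unitary $U$ between the Fock spaces. *)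

theory Defs
  imports "HOL-Analysis.Analysis" "HOL-Algebra.Group" "HOL-Combinatorics.Permutations"
begin

section \<open>Single vertex 2-graphs with one red edge\<close>

datatype edge = Blue nat | Red

definition words :: "nat \<Rightarrow> edge list set" where
  "words n = lists (insert Red (Blue ` {1..n}))"

text \<open>The congruence on words generated by the relations \<open>e\<^sub>i f = f e\<^bsub>\<tau>(i)\<^esub>\<close>.\<close>

inductive_set two_graph_rel :: "nat \<Rightarrow> (nat \<Rightarrow> nat) \<Rightarrow> (edge list \<times> edge list) set"
  for n :: nat and \<tau> :: "nat \<Rightarrow> nat" where
  commute: "\<lbrakk>i \<in> {1..n}; u \<in> words n; v \<in> words n\<rbrakk> \<Longrightarrow>
    (u @ [Blue i, Red] @ v, u @ [Red, Blue (\<tau> i)] @ v) \<in> two_graph_rel n \<tau>"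
| refl: "u \<in> words n \<Longrightarrow> (u, u) \<in> two_graph_rel n \<tau>"
| sym: "(u, v) \<in> two_graph_rel n \<tau> \<Longrightarrow> (v, u) \<in> two_graph_rel n \<tau>"
| trans: "(u, v) \<in> two_graph_rel n \<tau> \<Longrightarrow> (v, w) \<in> two_graph_rel n \<tau> \<Longrightarrow>
    (u, w) \<in> two_graph_rel n \<tau>"

definition two_graph :: "nat \<Rightarrow> (nat \<Rightarrow> nat) \<Rightarrow> edge list set monoid" where
  "two_graph n \<tau> =
    \<lparr>carrier = words n // two_graph_rel n \<tau>,
     monoid.mult = (\<lambda>X Y. \<Union>u\<in>X. \<Union>v\<in>Y. two_graph_rel n \<tau> `` {u @ v}),
     one = two_graph_rel n \<tau> `` {[]}\<rparr>"

text \<open>Moving all red letters to the left brings a word into the form \<open>f\<^sup>k e\<^bsub>i\<^sub>1\<^esub> \<dots> e\<^bsub>i\<^sub>m\<^esub>\<close>. This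
  normal form decides the congruence and yields left cancellation.\<close>

fun nf_act :: "(nat \<Rightarrow> nat) \<Rightarrow> edge \<Rightarrow> nat \<times> nat list \<Rightarrow> nat \<times> nat list" where
  "nf_act \<tau> (Blue i) (k, u) = (k, (\<tau> ^^ k) i # u)"
| "nf_act \<tau> Red (k, u) = (Suc k, u)"

definition normal_form :: "(nat \<Rightarrow> nat) \<Rightarrow> edge list \<Rightarrow> nat \<times> nat list" where
  "normal_form \<tau> w = foldr (nf_act \<tau>) w (0, [])"

definition nf_word :: "nat \<times> nat list \<Rightarrow> edge list" where
  "nf_word p = replicate (fst p) Red @ map Blue (snd p)"

lemma words_Nil [simp]: "[] \<in> words n"
  and words_Cons [simp]: "a # w \<in> words n \<longleftrightarrow> a \<in> insert Red (Blue ` {1..n}) \<and> w \<in> words n"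
  and words_append [simp]: "u @ v \<in> words n \<longleftrightarrow> u \<in> words n \<and> v \<in> words n"
  by (auto simp: words_def)

context
  fixes n :: nat and \<tau> :: "nat \<Rightarrow> nat"
  assumes perm: "\<tau> permutes {1..n}"
begin

lemma perm_in [simp]: "i \<in> {1..n} \<Longrightarrow> \<tau> i \<in> {1..n}"
  using perm permutes_in_image by metis

lemma two_graph_rel_words:
  assumes "(u, v) \<in> two_graph_rel n \<tau>" shows "u \<in> words n \<and> v \<in> words n"
  using assms
proof induction
  case (commute i u v)
  then show ?case using perm_in[of i] by auto
qed auto

lemma equiv_two_graph_rel: "equiv (words n) (two_graph_rel n \<tau>)"
proof (rule equivI)
  show "two_graph_rel n \<tau> \<subseteq> words n \<times> words n" using two_graph_rel_words by auto
  show "refl_on (words n) (two_graph_rel n \<tau>)" by (auto intro: refl_onI two_graph_rel.refl)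
  show "sym (two_graph_rel n \<tau>)" by (rule symI) (rule two_graph_rel.sym)
  show "trans (two_graph_rel n \<tau>)" by (rule transI) (rule two_graph_rel.trans)
qed

lemma two_graph_rel_append_left:
  assumes "(u, v) \<in> two_graph_rel n \<tau>" "w \<in> words n"
  shows "(w @ u, w @ v) \<in> two_graph_rel n \<tau>"
  using assms
proof induction
  case (commute i u v)
  then show ?case using two_graph_rel.commute[of i n "w @ u" v \<tau>] by simp
next
  case (trans u v x)
  then show ?case by (metis two_graph_rel.trans)
qed (simp_all add: two_graph_rel.refl two_graph_rel.sym)

lemma two_graph_rel_append_right:
  assumes "(u, v) \<in> two_graph_rel n \<tau>" "w \<in> words n"
  shows "(u @ w, v @ w) \<in> two_graph_rel n \<tau>"
  using assms
proof induction
  case (commute i u v)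
  then show ?case using two_graph_rel.commute[of i n u "v @ w" \<tau>] by simp
next
  case (trans u v x)
  then show ?case by (metis two_graph_rel.trans)
qed (simp_all add: two_graph_rel.refl two_graph_rel.sym)

lemma two_graph_rel_append:
  assumes "(u, u') \<in> two_graph_rel n \<tau>" "(v, v') \<in> two_graph_rel n \<tau>"
  shows "(u @ v, u' @ v') \<in> two_graph_rel n \<tau>"
proof (rule two_graph_rel.trans)
  show "(u @ v, u' @ v) \<in> two_graph_rel n \<tau>"
    using assms(1) two_graph_rel_words[OF assms(2)] by (simp add: two_graph_rel_append_right)
  show "(u' @ v, u' @ v') \<in> two_graph_rel n \<tau>"
    using assms(2) two_graph_rel_words[OF assms(1)] by (simp add: two_graph_rel_append_left)
qed

lemma two_graph_rel_imp_normal_form: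
  assumes "(u, v) \<in> two_graph_rel n \<tau>" shows "normal_form \<tau> u = normal_form \<tau> v"
  using assms
proof induction
  case (commute i u v)
  show ?case
    by (cases "foldr (nf_act \<tau>) v (0, [])") (simp add: normal_form_def funpow_swap1)
qed auto

lemma blue_past_reds:
  assumes "i \<in> {1..n}" "v \<in> words n"
  shows "(Blue i # replicate k Red @ v, replicate k Red @ Blue ((\<tau> ^^ k) i) # v) \<in> two_graph_rel n \<tau>"
  using assms(1)
proof (induction k arbitrary: i)
  case 0
  then show ?case using assms(2) by (auto intro: two_graph_rel.refl)
next
  case (Suc k)
  have r: "replicate k Red \<in> words n" by (auto simp: words_def)
  have "(Blue i # Red # replicate k Red @ v, Red # Blue (\<tau> i) # replicate k Red @ v) \<in> two_graph_rel n \<tau>"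
    using two_graph_rel.commute[of i n "[]" "replicate k Red @ v" \<tau>] Suc.prems r assms(2) by simp
  moreover have "(Red # Blue (\<tau> i) # replicate k Red @ v,
      Red # replicate k Red @ Blue ((\<tau> ^^ k) (\<tau> i)) # v) \<in> two_graph_rel n \<tau>"
    using two_graph_rel_append_left[OF Suc.IH[of "\<tau> i"], of "[Red]"] Suc.prems perm_in[of i] by simp
  ultimately show ?case using two_graph_rel.trans by (simp add: funpow_swap1)
qed

lemma two_graph_rel_nf_word:
  assumes "w \<in> words n" shows "(w, nf_word (normal_form \<tau> w)) \<in> two_graph_rel n \<tau>"
  using assms
proof (induction w)
  case Nil
  then show ?case by (auto simp: normal_form_def nf_word_def intro: two_graph_rel.refl)
next
  case (Cons a w)
  obtain k u where nf: "normal_form \<tau> w = (k, u)" by fastforce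
  have rel: "(w, replicate k Red @ map Blue u) \<in> two_graph_rel n \<tau>"
    using Cons nf by (simp add: nf_word_def)
  have rel': "(a # w, a # replicate k Red @ map Blue u) \<in> two_graph_rel n \<tau>"
    using two_graph_rel_append_left[OF rel, of "[a]"] Cons.prems by simp
  show ?case
  proof (cases a)
    case (Blue i)
    then have "i \<in> {1..n}" using Cons.prems by auto
    moreover have "map Blue u \<in> words n" using two_graph_rel_words[OF rel] by simp
    ultimately have "(a # w, replicate k Red @ Blue ((\<tau> ^^ k) i) # map Blue u) \<in> two_graph_rel n \<tau>"
      using two_graph_rel.trans[OF rel'] blue_past_reds Blue by simp
    then show ?thesis using nf Blue by (simp add: nf_word_def normal_form_def)
  next
    case Red
    then show ?thesis using rel' nf by (simp add: nf_word_def normal_form_def)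
  qed
qed

lemma two_graph_rel_iff:
  assumes "u \<in> words n" "v \<in> words n"
  shows "(u, v) \<in> two_graph_rel n \<tau> \<longleftrightarrow> normal_form \<tau> u = normal_form \<tau> v"
  using two_graph_rel_nf_word[OF assms(1)] two_graph_rel_nf_word[OF assms(2)]
    two_graph_rel_imp_normal_form
  by (metis two_graph_rel.sym two_graph_rel.trans)

lemma normal_form_append_cancel:
  assumes "normal_form \<tau> (u @ v) = normal_form \<tau> (u @ w)"
  shows "normal_form \<tau> v = normal_form \<tau> w"
proof -
  have "p = q" if "foldr (nf_act \<tau>) u p = foldr (nf_act \<tau>) u q" for p q
    using that
  proof (induction u)
    case (Cons a u)
    have "x = y" if "nf_act \<tau> a x = nf_act \<tau> a y" for x y
      using that by (cases a; cases x; cases y) auto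
    then show ?case using Cons by simp
  qed simp
  then show ?thesis using assms by (simp add: normal_form_def)
qed

lemma two_graph_carrierE:
  assumes "X \<in> carrier (two_graph n \<tau>)"
  obtains w where "w \<in> words n" "X = two_graph_rel n \<tau> `` {w}"
  using assms by (auto simp: two_graph_def elim: quotientE)

lemma two_graph_class_in_carrier [simp]:
  "w \<in> words n \<Longrightarrow> two_graph_rel n \<tau> `` {w} \<in> carrier (two_graph n \<tau>)"
  by (auto simp: two_graph_def intro: quotientI)

lemma two_graph_mult:
  assumes "u \<in> words n" "v \<in> words n"
  shows "two_graph_rel n \<tau> `` {u} \<otimes>\<^bsub>two_graph n \<tau>\<^esub> two_graph_rel n \<tau> `` {v} = two_graph_rel n \<tau> `` {u @ v}"
proof -
  have eq: "two_graph_rel n \<tau> `` {u' @ v'} = two_graph_rel n \<tau> `` {u @ v}"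
    if "u' \<in> two_graph_rel n \<tau> `` {u}" "v' \<in> two_graph_rel n \<tau> `` {v}" for u' v'
    using equiv_class_eq[OF equiv_two_graph_rel two_graph_rel_append] that by blast
  have "u \<in> two_graph_rel n \<tau> `` {u}" "v \<in> two_graph_rel n \<tau> `` {v}"
    using assms by (auto intro: two_graph_rel.refl)
  then have ne: "two_graph_rel n \<tau> `` {u} \<noteq> {}" "two_graph_rel n \<tau> `` {v} \<noteq> {}" by blast+
  have "two_graph_rel n \<tau> `` {u} \<otimes>\<^bsub>two_graph n \<tau>\<^esub> two_graph_rel n \<tau> `` {v} =
      (\<Union>u'\<in>two_graph_rel n \<tau> `` {u}. \<Union>v'\<in>two_graph_rel n \<tau> `` {v}. two_graph_rel n \<tau> `` {u' @ v'})"
    by (simp add: two_graph_def)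
  also have "\<dots> = (\<Union>u'\<in>two_graph_rel n \<tau> `` {u}. \<Union>v'\<in>two_graph_rel n \<tau> `` {v}. two_graph_rel n \<tau> `` {u @ v})"
    by (intro SUP_cong[OF HOL.refl] eq)
  also have "\<dots> = two_graph_rel n \<tau> `` {u @ v}"
    using ne by (simp only: UN_constant if_False)
  finally show ?thesis .
qed

lemma monoid_two_graph: "Group.monoid (two_graph n \<tau>)"
proof (rule Group.monoidI)
  have one: "\<one>\<^bsub>two_graph n \<tau>\<^esub> = two_graph_rel n \<tau> `` {[]}" by (simp add: two_graph_def)
  show "\<one>\<^bsub>two_graph n \<tau>\<^esub> \<in> carrier (two_graph n \<tau>)" by (simp add: one)
  fix x y z
  assume x: "x \<in> carrier (two_graph n \<tau>)"
  show "\<one>\<^bsub>two_graph n \<tau>\<^esub> \<otimes>\<^bsub>two_graph n \<tau>\<^esub> x = x" "x \<otimes>\<^bsub>two_graph n \<tau>\<^esub> \<one>\<^bsub>two_graph n \<tau>\<^esub> = x"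
    using x by (auto elim!: two_graph_carrierE simp: one two_graph_mult)
  assume y: "y \<in> carrier (two_graph n \<tau>)"
  show "x \<otimes>\<^bsub>two_graph n \<tau>\<^esub> y \<in> carrier (two_graph n \<tau>)"
    using x y by (auto elim!: two_graph_carrierE simp: two_graph_mult)
  assume z: "z \<in> carrier (two_graph n \<tau>)"
  show "x \<otimes>\<^bsub>two_graph n \<tau>\<^esub> y \<otimes>\<^bsub>two_graph n \<tau>\<^esub> z = x \<otimes>\<^bsub>two_graph n \<tau>\<^esub> (y \<otimes>\<^bsub>two_graph n \<tau>\<^esub> z)"
    using x y z by (auto elim!: two_graph_carrierE simp: two_graph_mult)
qed

lemma two_graph_left_cancel:
  assumes "v \<in> carrier (two_graph n \<tau>)"
  shows "inj_on (\<lambda>w. v \<otimes>\<^bsub>two_graph n \<tau>\<^esub> w) (carrier (two_graph n \<tau>))"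
proof (rule inj_onI)
  fix x y
  assume xy: "x \<in> carrier (two_graph n \<tau>)" "y \<in> carrier (two_graph n \<tau>)"
    and eq: "v \<otimes>\<^bsub>two_graph n \<tau>\<^esub> x = v \<otimes>\<^bsub>two_graph n \<tau>\<^esub> y"
  obtain a b c where abc: "a \<in> words n" "b \<in> words n" "c \<in> words n"
    and cls: "v = two_graph_rel n \<tau> `` {a}" "x = two_graph_rel n \<tau> `` {b}" "y = two_graph_rel n \<tau> `` {c}"
    using assms xy by (metis two_graph_carrierE)
  have "two_graph_rel n \<tau> `` {a @ b} = two_graph_rel n \<tau> `` {a @ c}"
    using eq abc by (simp add: cls two_graph_mult)
  then have "(a @ b, a @ c) \<in> two_graph_rel n \<tau>"
    using eq_equiv_class[OF _ equiv_two_graph_rel] abc by simp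
  then have "(b, c) \<in> two_graph_rel n \<tau>"
    using abc two_graph_rel_iff normal_form_append_cancel two_graph_rel_imp_normal_form by metis
  then show "x = y" unfolding cls by (rule equiv_class_eq[OF equiv_two_graph_rel])
qed

end


section \<open>The Hilbert space of square summable families\<close>

definition square_summable :: "('a \<Rightarrow> complex) \<Rightarrow> bool" where
  "square_summable x \<longleftrightarrow> (\<lambda>i. (cmod (x i))\<^sup>2) summable_on UNIV"

lemma square_summable_zero: "square_summable (\<lambda>_. 0)"
  by (simp add: square_summable_def)

lemma square_summable_scale:
  assumes "square_summable x" shows "square_summable (\<lambda>i. c * x i)"
  using assms unfolding square_summable_def
  by (simp add: norm_mult power_mult_distrib summable_on_cmult_right)

lemma square_summable_add:
  assumes "square_summable x" "square_summable y" shows "square_summable (\<lambda>i. x i + y i)"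
proof -
  have "(\<lambda>i. 2 * (cmod (x i))\<^sup>2 + 2 * (cmod (y i))\<^sup>2) summable_on UNIV"
    using assms unfolding square_summable_def
    by (intro summable_on_add summable_on_cmult_right)
  moreover have "(cmod (a + b))\<^sup>2 \<le> 2 * (cmod a)\<^sup>2 + 2 * (cmod b)\<^sup>2" for a b
  proof -
    have "(cmod (a + b))\<^sup>2 \<le> (cmod a + cmod b)\<^sup>2"
      by (intro power_mono norm_triangle_ineq) auto
    moreover have "0 \<le> (cmod a - cmod b)\<^sup>2" by simp
    ultimately show ?thesis by (simp add: power2_sum power2_diff)
  qed
  ultimately show ?thesis unfolding square_summable_def
    by (auto intro: summable_on_comparison_test)
qed

lemma square_summable_product:
  assumes "square_summable x" "square_summable y"
  shows "(\<lambda>i. x i * cnj (y i)) summable_on UNIV"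
proof (rule abs_summable_summable)
  have *: "(\<lambda>i. (cmod (x i))\<^sup>2 + (cmod (y i))\<^sup>2) summable_on UNIV"
    using assms unfolding square_summable_def by (intro summable_on_add)
  have "cmod a * cmod b \<le> (cmod a)\<^sup>2 + (cmod b)\<^sup>2" for a b
    using sum_squares_bound[of "cmod a" "cmod b"] mult_nonneg_nonneg[of "cmod a" "cmod b"]
    by (simp del: mult_nonneg_nonneg)
  then show "(\<lambda>i. cmod (x i * cnj (y i))) summable_on UNIV"
    by (intro summable_on_comparison_test[OF *]) (auto simp: norm_mult)
qed

typedef 'a ell2 = "{x :: 'a \<Rightarrow> complex. square_summable x}"
  morphisms coord Abs_ell2
  using square_summable_zero by auto

setup_lifting type_definition_ell2

lift_definition cscale :: "complex \<Rightarrow> 'a ell2 \<Rightarrow> 'a ell2" is "\<lambda>c x i. c * x i"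
  by (rule square_summable_scale)

lift_definition cinner :: "'a ell2 \<Rightarrow> 'a ell2 \<Rightarrow> complex" is
  "\<lambda>x y. infsum (\<lambda>i. x i * cnj (y i)) UNIV" .

instantiation ell2 :: (type) real_vector
begin

lift_definition zero_ell2 :: "'a ell2" is "\<lambda>_. 0"
  by (rule square_summable_zero)

lift_definition plus_ell2 :: "'a ell2 \<Rightarrow> 'a ell2 \<Rightarrow> 'a ell2" is "\<lambda>x y i. x i + y i"
  by (rule square_summable_add)

lift_definition uminus_ell2 :: "'a ell2 \<Rightarrow> 'a ell2" is "\<lambda>x i. - x i"
  by (simp add: square_summable_def)

lift_definition minus_ell2 :: "'a ell2 \<Rightarrow> 'a ell2 \<Rightarrow> 'a ell2" is "\<lambda>x y i. x i - y i"
  using square_summable_add[OF _ square_summable_scale[of _ "-1"]] by fastforce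

lift_definition scaleR_ell2 :: "real \<Rightarrow> 'a ell2 \<Rightarrow> 'a ell2" is "\<lambda>r x i. complex_of_real r * x i"
  by (rule square_summable_scale)

instance
proof
  fix x y z :: "'a ell2" and a b :: real
  show "x + y + z = x + (y + z)" "x + y = y + x" "0 + x = x" "- x + x = 0" "x - y = x + - y"
    by (transfer; simp add: fun_eq_iff)+
  show "a *\<^sub>R (x + y) = a *\<^sub>R x + a *\<^sub>R y" "(a + b) *\<^sub>R x = a *\<^sub>R x + b *\<^sub>R x"
    "a *\<^sub>R b *\<^sub>R x = (a * b) *\<^sub>R x" "1 *\<^sub>R x = x"
    by (transfer; simp add: fun_eq_iff algebra_simps)+
qed

end

lemma cinner_self:
  "cinner x x = complex_of_real (infsum (\<lambda>i. (cmod (coord x i))\<^sup>2) UNIV)"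
proof -
  have "(\<lambda>i. (cmod (coord x i))\<^sup>2) summable_on UNIV"
    using coord[of x] by (simp add: square_summable_def)
  from has_sum_of_real[OF has_sum_infsum[OF this], where 'a = complex]
  have "infsum (\<lambda>i. complex_of_real ((cmod (coord x i))\<^sup>2)) UNIV =
      complex_of_real (infsum (\<lambda>i. (cmod (coord x i))\<^sup>2) UNIV)"
    by (rule infsumI)
  then show ?thesis by (simp only: cinner.rep_eq complex_norm_square)
qed

instantiation ell2 :: (type) real_inner
begin

definition inner_ell2 :: "'a ell2 \<Rightarrow> 'a ell2 \<Rightarrow> real" where
  "inner_ell2 x y = Re (cinner x y)"

definition norm_ell2 :: "'a ell2 \<Rightarrow> real" where "norm_ell2 x = sqrt (inner x x)"
definition sgn_ell2 :: "'a ell2 \<Rightarrow> 'a ell2" where "sgn_ell2 x = scaleR (inverse (norm x)) x"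
definition dist_ell2 :: "'a ell2 \<Rightarrow> 'a ell2 \<Rightarrow> real" where "dist_ell2 x y = norm (x - y)"
definition uniformity_ell2 :: "('a ell2 \<times> 'a ell2) filter" where
  "uniformity_ell2 = (INF e\<in>{0<..}. principal {(x, y). dist x y < e})"
definition open_ell2 :: "'a ell2 set \<Rightarrow> bool" where
  "open_ell2 U \<longleftrightarrow> (\<forall>x\<in>U. \<forall>\<^sub>F (x', y) in uniformity. x' = x \<longrightarrow> y \<in> U)"

instance
proof
  fix x y z :: "'a ell2" and a b :: real
  show "dist x y = norm (x - y)" by (rule dist_ell2_def)
  show "sgn x = x /\<^sub>R norm x" by (rule sgn_ell2_def)
  show "uniformity = (INF e\<in>{0<..}. principal {(x, y :: 'a ell2). dist x y < e})"
    by (rule uniformity_ell2_def)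
  show "open U \<longleftrightarrow> (\<forall>x\<in>U. \<forall>\<^sub>F (x', y) in uniformity. x' = x \<longrightarrow> y \<in> U)" for U :: "'a ell2 set"
    by (rule open_ell2_def)
  show "norm x = sqrt (inner x x)" by (rule norm_ell2_def)
  have cnj: "cinner y x = cnj (cinner x y)"
    by transfer (simp flip: infsum_cnj add: mult.commute)
  show "inner x y = inner y x"
    unfolding inner_ell2_def cnj by simp
  have "cinner (x + y) z = cinner x z + cinner y z"
    by transfer (simp add: distrib_right infsum_add square_summable_product)
  then show "inner (x + y) z = inner x z + inner y z"
    by (simp add: inner_ell2_def)
  have "cinner (a *\<^sub>R x) y = complex_of_real a * cinner x y"
    by transfer (simp add: mult.assoc infsum_cmult_right square_summable_product)
  then show "inner (a *\<^sub>R x) y = a * inner x y"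
    by (simp add: inner_ell2_def)
  show "0 \<le> inner x x"
    by (simp add: inner_ell2_def cinner_self infsum_nonneg)
  show "inner x x = 0 \<longleftrightarrow> x = 0"
  proof
    assume "inner x x = 0"
    then have *: "infsum (\<lambda>i. (cmod (coord x i))\<^sup>2) UNIV = 0"
      by (simp add: inner_ell2_def cinner_self)
    have "(cmod (coord x i))\<^sup>2 = 0" for i
      by (rule nonneg_infsum_le_0D[where A = UNIV])
        (use * coord[of x] in \<open>auto simp: square_summable_def\<close>)
    then show "x = 0" by (intro coord_inject[THEN iffD1]) (auto simp: zero_ell2.rep_eq)
  next
    assume "x = 0" then show "inner x x = 0"
      by (simp add: inner_ell2_def cinner_def zero_ell2.rep_eq)
  qed
qed

end

lemma norm_ell2_square: "(norm x)\<^sup>2 = infsum (\<lambda>i. (cmod (coord x i))\<^sup>2) UNIV"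
  by (simp add: norm_ell2_def inner_ell2_def cinner_self infsum_nonneg)

lemma norm_cscale: "norm (cscale c x) = cmod c * norm x"
proof -
  have "(norm (cscale c x))\<^sup>2 = (cmod c * norm x)\<^sup>2"
    by (simp add: norm_ell2_square cscale.rep_eq norm_mult power_mult_distrib infsum_cmult_right')
  then show ?thesis
    by (metis norm_ge_zero power2_eq_iff_nonneg mult_nonneg_nonneg)
qed

lemma bounded_linear_cscale: "bounded_linear (cscale c :: 'a ell2 \<Rightarrow> 'a ell2)"
proof (rule bounded_linear_intro)
  show "cscale c (x + y) = cscale c x + cscale c y" for x y :: "'a ell2"
    by transfer (simp add: distrib_left)
  show "cscale c (r *\<^sub>R x) = r *\<^sub>R cscale c x" for r and x :: "'a ell2"
    by transfer (simp add: mult.left_commute)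
  show "norm (cscale c x) \<le> norm x * cmod c" for x :: "'a ell2"
    by (simp add: norm_cscale)
qed

text \<open>Completeness is not needed to state anything below; it confirms that \<open>'a ell2\<close> is a
  Hilbert space.\<close>

lemma cmod_coord_le: "cmod (coord x i) \<le> norm x"
proof -
  have "sum (\<lambda>i. (cmod (coord x i))\<^sup>2) {i} \<le> infsum (\<lambda>i. (cmod (coord x i))\<^sup>2) UNIV"
    by (rule finite_sum_le_infsum) (use coord[of x] in \<open>auto simp: square_summable_def\<close>)
  then show ?thesis by (simp flip: norm_ell2_square)
qed

instance ell2 :: (type) complete_space
proof
  fix X :: "nat \<Rightarrow> 'a ell2" assume C: "Cauchy X"
  have coord_diff: "coord (x - y) i = coord x i - coord y i" for x y :: "'a ell2" and i
    by (simp add: minus_ell2.rep_eq)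
  have "Cauchy (\<lambda>n. coord (X n) i)" for i
  proof (rule CauchyI)
    fix e :: real assume "e > 0"
    then obtain N where "\<forall>m\<ge>N. \<forall>n\<ge>N. norm (X m - X n) < e" using CauchyD[OF C] by blast
    then show "\<exists>N. \<forall>m\<ge>N. \<forall>n\<ge>N. norm (coord (X m) i - coord (X n) i) < e"
      using cmod_coord_le[of _ i] by (metis coord_diff order_le_less_trans)
  qed
  then have "\<forall>i. \<exists>a. (\<lambda>n. coord (X n) i) \<longlonglongrightarrow> a"
    by (simp add: Cauchy_convergent_iff convergent_def)
  then obtain l where l: "\<And>i. (\<lambda>n. coord (X n) i) \<longlonglongrightarrow> l i"
    by (auto dest!: choice)
  have key: "(\<Sum>i\<in>F. (cmod (coord (X m) i - l i))\<^sup>2) \<le> e\<^sup>2"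
    if "finite F" "\<forall>n\<ge>N. norm (X m - X n) < e" for F N m and e :: real
  proof (rule LIMSEQ_le_const2)
    show "(\<lambda>n. \<Sum>i\<in>F. (cmod (coord (X m) i - coord (X n) i))\<^sup>2)
        \<longlonglongrightarrow> (\<Sum>i\<in>F. (cmod (coord (X m) i - l i))\<^sup>2)"
      by (intro tendsto_intros l)
    have "(\<Sum>i\<in>F. (cmod (coord (X m) i - coord (X n) i))\<^sup>2) \<le> e\<^sup>2" if "n \<ge> N" for n
    proof -
      have "(\<Sum>i\<in>F. (cmod (coord (X m - X n) i))\<^sup>2) \<le> (norm (X m - X n))\<^sup>2"
        unfolding norm_ell2_square using coord[of "X m - X n"] \<open>finite F\<close>
        by (intro finite_sum_le_infsum) (auto simp: square_summable_def)
      also have "\<dots> \<le> e\<^sup>2"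
        using \<open>\<forall>n\<ge>N. norm (X m - X n) < e\<close> that by (intro power_mono) (auto intro: less_imp_le)
      finally show ?thesis by (simp add: coord_diff)
    qed
    then show "\<exists>N. \<forall>n\<ge>N. (\<Sum>i\<in>F. (cmod (coord (X m) i - coord (X n) i))\<^sup>2) \<le> e\<^sup>2" by blast
  qed
  have ss: "square_summable (\<lambda>i. coord (X m) i - l i)" if "\<forall>n\<ge>N. norm (X m - X n) < e"
    for m N and e :: real
    unfolding square_summable_def
  proof (rule nonneg_bdd_above_summable_on)
    show "bdd_above (sum (\<lambda>i. (cmod (coord (X m) i - l i))\<^sup>2) ` {F. F \<subseteq> UNIV \<and> finite F})"
      by (rule bdd_aboveI2[where M = "e\<^sup>2"]) (simp add: key[OF _ that])
  qed simp
  obtain N where N: "\<forall>m\<ge>N. \<forall>n\<ge>N. norm (X m - X n) < 1" using CauchyD[OF C] zero_less_one by blast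
  have "square_summable (\<lambda>i. coord (X N) i + (-1) * (coord (X N) i - l i))"
  proof (intro square_summable_add square_summable_scale)
    show "square_summable (coord (X N))" using coord[of "X N"] by simp
    show "square_summable (\<lambda>i. coord (X N) i - l i)" by (rule ss[of N N 1]) (simp add: N)
  qed
  then have "square_summable l" by simp
  then have cl: "coord (Abs_ell2 l) = l" by (simp add: Abs_ell2_inverse)
  have "X \<longlonglongrightarrow> Abs_ell2 l"
  proof (rule LIMSEQ_I)
    fix r :: real assume "r > 0"
    then obtain M where M: "\<forall>m\<ge>M. \<forall>n\<ge>M. norm (X m - X n) < r / 2"
      using CauchyD[OF C, of "r / 2"] by auto
    have "norm (X m - Abs_ell2 l) < r" if "m \<ge> M" for m
    proof -
      have "(norm (X m - Abs_ell2 l))\<^sup>2 \<le> (r / 2)\<^sup>2"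
        unfolding norm_ell2_square coord_diff cl
      proof (rule infsum_le_finite_sums)
        have *: "\<forall>n\<ge>M. norm (X m - X n) < r / 2" using M that by blast
        show "(\<lambda>i. (cmod (coord (X m) i - l i))\<^sup>2) summable_on UNIV"
          using ss[OF *] by (simp only: square_summable_def)
        show "(\<Sum>i\<in>F. (cmod (coord (X m) i - l i))\<^sup>2) \<le> (r / 2)\<^sup>2" if "finite F" for F
          by (rule key[OF that *])
      qed
      then have "norm (X m - Abs_ell2 l) \<le> r / 2"
        by (rule power2_le_imp_le) (use \<open>r > 0\<close> in simp)
      then show ?thesis using \<open>r > 0\<close> by simp
    qed
    then show "\<exists>M. \<forall>m\<ge>M. norm (X m - Abs_ell2 l) < r" by blast
  qed
  then show "convergent X" by (auto simp: convergent_def)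
qed


section \<open>Operator algebras on the Fock space\<close>

lift_definition ket :: "'a \<Rightarrow> 'a ell2" is "\<lambda>w i. if i = w then 1 else 0"
  by (auto simp: square_summable_def intro!: finite_nonzero_values_imp_summable_on)

text \<open>The carrier of a monoid is in general only a part of its type, so the Fock space is the
  subspace of families supported on the carrier. A bounded operator on the Fock space is
  represented by its extension by \<open>0\<close> on the orthogonal complement; this changes neither sums,
  products, norms nor weak operator limits. In particular, the identity of the Fock space is
  represented by the orthogonal projection onto it, which is \<open>creation M \<one>\<^bsub>M\<^esub>\<close>.\<close>

definition fock :: "('a, 'm) monoid_scheme \<Rightarrow> 'a ell2 set" where
  "fock M = {x. \<forall>i. i \<notin> carrier M \<longrightarrow> coord x i = 0}"

type_synonym 'a ell2_op = "'a ell2 \<Rightarrow>\<^sub>L 'a ell2"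

text \<open>\<open>creation M v\<close> is the operator \<open>L\<^sub>v\<close>; see \<open>creation_ket\<close> below. It is well defined when left
  multiplication by \<open>v\<close> is injective.\<close>

definition shift :: "('a, 'm) monoid_scheme \<Rightarrow> 'a \<Rightarrow> ('a \<Rightarrow> complex) \<Rightarrow> 'a \<Rightarrow> complex" where
  "shift M v x u = (if u \<in> (\<lambda>w. v \<otimes>\<^bsub>M\<^esub> w) ` carrier M
     then x (inv_into (carrier M) (\<lambda>w. v \<otimes>\<^bsub>M\<^esub> w) u) else 0)"

definition creation :: "('a, 'm) monoid_scheme \<Rightarrow> 'a \<Rightarrow> 'a ell2_op" where
  "creation M v = Blinfun (\<lambda>x. Abs_ell2 (shift M v (coord x)))"

definition cscale_op :: "complex \<Rightarrow> 'a ell2_op \<Rightarrow> 'a ell2_op" where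
  "cscale_op c T = Blinfun (\<lambda>x. cscale c (T x))"

definition weak_operator_topology :: "'a ell2_op topology" where
  "weak_operator_topology =
     pullback_topology UNIV (\<lambda>T (x, y). cinner (blinfun_apply T x) y) euclidean"

definition op_subalgebra :: "'a ell2_op set \<Rightarrow> bool" where
  "op_subalgebra B \<longleftrightarrow> 0 \<in> B \<and> (\<forall>S\<in>B. \<forall>T\<in>B. S + T \<in> B \<and> S o\<^sub>L T \<in> B) \<and>
     (\<forall>c. \<forall>T\<in>B. cscale_op c T \<in> B)"

definition A_alg :: "('a, 'm) monoid_scheme \<Rightarrow> 'a ell2_op set" where
  "A_alg M = (\<lambda>B. op_subalgebra B \<and> closed B) hull (creation M ` carrier M)"

definition L_alg :: "('a, 'm) monoid_scheme \<Rightarrow> 'a ell2_op set" where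
  "L_alg M = (\<lambda>B. op_subalgebra B \<and> closedin weak_operator_topology B) hull (creation M ` carrier M)"

definition isometrically_isomorphic :: "'a ell2_op set \<Rightarrow> 'b ell2_op set \<Rightarrow> bool" where
  "isometrically_isomorphic A B \<longleftrightarrow> (\<exists>\<phi>. bij_betw \<phi> A B \<and>
     (\<forall>S\<in>A. \<forall>T\<in>A. \<phi> (S + T) = \<phi> S + \<phi> T \<and> \<phi> (S o\<^sub>L T) = \<phi> S o\<^sub>L \<phi> T) \<and>
     (\<forall>c. \<forall>T\<in>A. \<phi> (cscale_op c T) = cscale_op c (\<phi> T)) \<and>
     (\<forall>T\<in>A. norm (\<phi> T) = norm T))"

text \<open>Only the restriction of \<open>U\<close> to \<open>fock M\<close> is relevant.\<close>

definition fock_unitary ::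
  "('a, 'm) monoid_scheme \<Rightarrow> ('b, 'k) monoid_scheme \<Rightarrow> ('a ell2 \<Rightarrow> 'b ell2) \<Rightarrow> bool" where
  "fock_unitary M N U \<longleftrightarrow> bij_betw U (fock M) (fock N) \<and>
     (\<forall>x\<in>fock M. \<forall>y\<in>fock M. U (x + y) = U x + U y \<and> cinner (U x) (U y) = cinner x y) \<and>
     (\<forall>c. \<forall>x\<in>fock M. U (cscale c x) = cscale c (U x))"

text \<open>The condition \<open>T (U x) = U (S x)\<close> on \<open>fock M\<close> says \<open>T = U S U\<^sup>*\<close>, so the two conjuncts are the
  two inclusions of \<open>U \<L>\<^sub>M U\<^sup>* = \<L>\<^sub>N\<close>.\<close>

definition L_alg_unitarily_equivalent ::
  "('a, 'm) monoid_scheme \<Rightarrow> ('b, 'k) monoid_scheme \<Rightarrow> bool" where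
  "L_alg_unitarily_equivalent M N \<longleftrightarrow> (\<exists>U. fock_unitary M N U \<and>
     (\<forall>S\<in>L_alg M. \<exists>T\<in>L_alg N. \<forall>x\<in>fock M. T (U x) = U (S x)) \<and>
     (\<forall>T\<in>L_alg N. \<exists>S\<in>L_alg M. \<forall>x\<in>fock M. T (U x) = U (S x)))"

subsection \<open>The operators \<open>L\<^sub>v\<close> and scalar multiples are well defined\<close>

lemma coord_add: "coord (x + y) i = coord x i + coord y i"
  and coord_scaleR: "coord (r *\<^sub>R x) i = complex_of_real r * coord x i"
  by (simp_all add: plus_ell2.rep_eq scaleR_ell2.rep_eq)

lemma cscale_op_apply: "blinfun_apply (cscale_op c T) x = cscale c (T x)"
  unfolding cscale_op_def
  by (subst bounded_linear_Blinfun_apply)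
    (auto intro: bounded_linear_compose[OF bounded_linear_cscale] blinfun.bounded_linear_right)

context
  fixes M :: "('a, 'm) monoid_scheme" and v :: 'a
  assumes inj: "inj_on (\<lambda>w. v \<otimes>\<^bsub>M\<^esub> w) (carrier M)"
begin

private lemma shift_has_sum:
  "((\<lambda>u. (cmod (shift M v (coord x) u))\<^sup>2) has_sum infsum (\<lambda>i. (cmod (coord x i))\<^sup>2) (carrier M)) UNIV"
proof -
  have "(\<lambda>i. (cmod (coord x i))\<^sup>2) summable_on carrier M"
    using coord[of x] by (auto simp: square_summable_def intro: summable_on_subset_banach)
  then have "((\<lambda>i. (cmod (coord x i))\<^sup>2) has_sum infsum (\<lambda>i. (cmod (coord x i))\<^sup>2) (carrier M)) (carrier M)"
    by simp
  then have "(((\<lambda>u. (cmod (shift M v (coord x) u))\<^sup>2) \<circ> (\<lambda>w. v \<otimes>\<^bsub>M\<^esub> w)) has_sum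
      infsum (\<lambda>i. (cmod (coord x i))\<^sup>2) (carrier M)) (carrier M)"
    by (rule has_sum_cong[THEN iffD1, rotated]) (simp add: inj shift_def)
  then have "((\<lambda>u. (cmod (shift M v (coord x) u))\<^sup>2) has_sum infsum (\<lambda>i. (cmod (coord x i))\<^sup>2) (carrier M))
      ((\<lambda>w. v \<otimes>\<^bsub>M\<^esub> w) ` carrier M)"
    using has_sum_reindex[OF inj] by blast
  then show ?thesis
    by (rule has_sum_cong_neutral[THEN iffD1, rotated 3]) (auto simp: shift_def)
qed

private lemma coord_shift: "coord (Abs_ell2 (shift M v (coord x))) = shift M v (coord x)"
proof -
  have "square_summable (shift M v (coord x))"
    unfolding square_summable_def using shift_has_sum by (rule has_sum_imp_summable)
  then show ?thesis by (simp add: Abs_ell2_inverse)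
qed

private lemma norm_shift:
  "(norm (Abs_ell2 (shift M v (coord x))))\<^sup>2 = infsum (\<lambda>i. (cmod (coord x i))\<^sup>2) (carrier M)"
  unfolding norm_ell2_square coord_shift using shift_has_sum by (rule infsumI)

private lemma norm_shift_le: "norm (Abs_ell2 (shift M v (coord x))) \<le> norm x"
proof (rule power2_le_imp_le)
  have "(\<lambda>i. (cmod (coord x i))\<^sup>2) summable_on UNIV"
    using coord[of x] by (simp add: square_summable_def)
  then show "(norm (Abs_ell2 (shift M v (coord x))))\<^sup>2 \<le> (norm x)\<^sup>2"
    unfolding norm_shift norm_ell2_square[of x]
    by (intro infsum_mono2) (auto intro: summable_on_subset_banach)
qed simp

lemma creation_coord: "coord (creation M v x) u = shift M v (coord x) u"
  and norm_creation: "x \<in> fock M \<Longrightarrow> norm (creation M v x) = norm x"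
proof -
  have "bounded_linear (\<lambda>x. Abs_ell2 (shift M v (coord x)))"
  proof (rule bounded_linear_intro)
    show "norm (Abs_ell2 (shift M v (coord x))) \<le> norm x * 1" for x by (simp only: norm_shift_le mult_1_right)
  qed (simp_all only: coord_inject[symmetric] fun_eq_iff coord_add coord_scaleR coord_shift, simp_all add: shift_def coord_add coord_scaleR)
  then have *: "creation M v x = Abs_ell2 (shift M v (coord x))" for x
    unfolding creation_def by (simp only: bounded_linear_Blinfun_apply)
  show "coord (creation M v x) u = shift M v (coord x) u"
    by (simp only: * coord_shift)
  assume "x \<in> fock M"
  then have "(norm (creation M v x))\<^sup>2 = (norm x)\<^sup>2"
    unfolding * norm_shift norm_ell2_square[of x]
    by (intro infsum_cong_neutral) (auto simp: fock_def)
  then show "norm (creation M v x) = norm x"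
    by (simp only: power2_eq_iff_nonneg[OF norm_ge_zero norm_ge_zero])
qed

lemma creation_ket: "w \<in> carrier M \<Longrightarrow> creation M v (ket w) = ket (v \<otimes>\<^bsub>M\<^esub> w)"
  using inj by (auto simp: coord_inject[symmetric] fun_eq_iff creation_coord shift_def ket.rep_eq
      inv_into_f_f dest: inj_onD)

end

end

theory Submission
  imports Defs "Jordan_Normal_Form.Determinant"
begin

text \<open>An isomorphism of the two semigroups identifies the orthonormal bases of the Fock spaces, and
  conjugation with the resulting unitary carries each \<open>L\<^sub>v\<close> to the operator of the image of \<open>v\<close>. This
  gives both kinds of equivalence of the algebras (\<open>is_iso_imp_equivalent_algebras\<close>).

  Conversely, the algebras determine the semigroup through words of length at most two. Every
  operator \<open>T\<close> in \<open>\<A>\<^sub>\<Lambda>\<close> or \<open>\<L>\<^sub>\<Lambda>\<close> is left convolution by the family \<open>T \<xi>\<^sub>1\<close>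
  (\<open>generated_algebra_left_convolution\<close>), so the coefficients of \<open>T \<xi>\<^sub>1\<close> multiply like those of a
  formal power series over \<open>\<Lambda>\<close>. Let \<open>\<phi>\<close> be an isomorphism from the algebra of \<open>\<Lambda>\<^sub>2\<close> to that of
  \<open>\<Lambda>\<^sub>1\<close>, and write, up to words of length at least two,
  \<open>\<phi> e\<^sub>i = \<alpha>\<^sub>i + x\<^sub>i + \<dots>\<close> and \<open>\<phi> f = \<beta> + y + \<dots>\<close>, where \<open>x\<^sub>i\<close> and \<open>y\<close> are linear combinations
  of the generators of \<open>\<Lambda>\<^sub>1\<close>.

  A linear functional that kills all \<open>x\<^sub>i\<close> and \<open>y\<close> defines a continuous point derivation vanishing on
  the generators of the algebra of \<open>\<Lambda>\<^sub>2\<close>, hence everywhere; as \<open>\<phi>\<close> is onto, the functional is zero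
  (\<open>generator_coefficients_trivial_kernel\<close>). So \<open>n\<^sub>1 \<le> n\<^sub>2\<close>, by symmetry \<open>n\<^sub>1 = n\<^sub>2 = n\<close>, and the \<open>x\<^sub>i\<close>
  and \<open>y\<close> form a basis. The linear part of the relation \<open>e\<^sub>i f = f e\<^bsub>\<tau>(i)\<^esub>\<close>, with \<open>\<tau> = \<tau>\<^sub>2\<close>, is
  \<open>(\<alpha>\<^sub>i - \<alpha>\<^bsub>\<tau>(i)\<^esub>) y + \<beta> (x\<^sub>i - x\<^bsub>\<tau>(i)\<^esub>) = 0\<close>. Independence gives \<open>\<alpha>\<^sub>i = \<alpha>\<^bsub>\<tau>(i)\<^esub>\<close>, and \<open>\<beta> = 0\<close> or
  \<open>\<tau>(i) = i\<close>. Therefore the constant terms cancel in degree two as well, wherever \<open>\<phi>\<close> sends the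
  vacuum character, and what remains is \<open>x\<^sub>i y = y x\<^bsub>\<tau>(i)\<^esub>\<close> among the words of length two over
  \<open>\<Lambda>\<^sub>1\<close>.

  If \<open>n \<ge> 2\<close>, this forces \<open>y\<close> to be a multiple of \<open>f\<close>, and then the matrix \<open>A\<close> of blue coefficients
  of the \<open>x\<^sub>i\<close> is invertible and intertwines the permutation matrices of \<open>\<tau>\<^sub>1\<close> and \<open>\<tau>\<^sub>2\<close>
  (\<open>quadratic_relations_imp_conjugate\<close>). Similar permutation matrices have powers of equal trace,
  so all powers of \<open>\<tau>\<^sub>1\<close> and \<open>\<tau>\<^sub>2\<close> have equally many fixed points, and the permutations are
  conjugate (\<open>equal_fixed_point_counts_imp_conjugate\<close>). A conjugating permutation relabels the blue
  edges and gives an isomorphism of the semigroups (\<open>conjugate_imp_is_iso\<close>). For \<open>n \<le> 1\<close> both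
  permutations are the identity.\<close>

section \<open>Linear systems with trivial kernel\<close>

lemma det_zero_imp_kernel:
  fixes A :: "'a::field mat"
  assumes A: "A \<in> carrier_mat (Suc n) (Suc n)" and "Determinant.det A = 0"
  obtains l where "\<exists>j\<le>n. l j \<noteq> 0" "\<And>i. i \<le> n \<Longrightarrow> (\<Sum>j\<le>n. A $$ (i, j) * l j) = 0"
proof -
  obtain v where v: "v \<in> carrier_vec (Suc n)" "v \<noteq> 0\<^sub>v (Suc n)" "A *\<^sub>v v = 0\<^sub>v (Suc n)"
    using det_0_iff_vec_prod_zero[OF A] assms(2) by auto
  have "\<exists>j\<le>n. vec_index v j \<noteq> 0"
  proof (rule ccontr)
    assume "\<not> (\<exists>j\<le>n. vec_index v j \<noteq> 0)"
    then have "v = 0\<^sub>v (Suc n)" using v(1) by (intro eq_vecI) auto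
    then show False using v(2) by simp
  qed
  moreover have "(\<Sum>j\<le>n. A $$ (i, j) * vec_index v j) = 0" if "i \<le> n" for i
  proof -
    have "vec_index (A *\<^sub>v v) i = (\<Sum>j\<le>n. A $$ (i, j) * vec_index v j)"
      using that v(1) A
      by (simp add: scalar_prod_def atMost_atLeast0 atLeastLessThanSuc_atLeastAtMost del: sum.op_ivl_Suc)
    then show ?thesis using v(3) that by simp
  qed
  ultimately show ?thesis by (rule that)
qed

lemma trivial_kernel_imp_le:
  fixes X :: "nat \<Rightarrow> nat \<Rightarrow> 'a::field"
  assumes ker: "\<And>l. (\<And>i. i \<le> m \<Longrightarrow> (\<Sum>j\<le>n. X i j * l j) = 0) \<Longrightarrow> \<forall>j\<le>n. l j = 0"
  shows "n \<le> m"
proof (rule ccontr)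
  assume "\<not> n \<le> m"
  \<comment> \<open>Padding with zero rows makes the system square and singular.\<close>
  define A where "A = mat (Suc n) (Suc n) (\<lambda>(i, j). if i \<le> m then X i j else 0)"
  have A: "A \<in> carrier_mat (Suc n) (Suc n)" by (simp add: A_def)
  have "Determinant.det A = (\<Sum>j<Suc n. A $$ (n, j) * cofactor A n j)"
    using laplace_expansion_row[OF A] by simp
  also have "\<dots> = 0" using \<open>\<not> n \<le> m\<close> by (intro sum.neutral) (simp add: A_def)
  finally obtain l where l: "\<exists>j\<le>n. l j \<noteq> 0" "\<And>i. i \<le> n \<Longrightarrow> (\<Sum>j\<le>n. A $$ (i, j) * l j) = 0"
    using det_zero_imp_kernel[OF A] by blast
  have "(\<Sum>j\<le>n. X i j * l j) = 0" if "i \<le> m" for i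
    using l(2)[of i] that \<open>\<not> n \<le> m\<close> by (simp add: A_def)
  then have "\<forall>j\<le>n. l j = 0" by (rule ker)
  then show False using l(1) by blast
qed

lemma trivial_kernel_imp_inverse:
  fixes X :: "nat \<Rightarrow> nat \<Rightarrow> 'a::field"
  assumes ker: "\<And>l. (\<And>i. i \<le> n \<Longrightarrow> (\<Sum>j\<le>n. X i j * l j) = 0) \<Longrightarrow> \<forall>j\<le>n. l j = 0"
  obtains Z where "\<And>i k. i \<le> n \<Longrightarrow> k \<le> n \<Longrightarrow> (\<Sum>j\<le>n. X i j * Z j k) = (if i = k then 1 else 0)"
    and "\<And>i k. i \<le> n \<Longrightarrow> k \<le> n \<Longrightarrow> (\<Sum>j\<le>n. Z i j * X j k) = (if i = k then 1 else 0)"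
proof -
  define A where "A = mat (Suc n) (Suc n) (\<lambda>(i, j). X i j)"
  have A: "A \<in> carrier_mat (Suc n) (Suc n)" by (simp add: A_def)
  have "Determinant.det A \<noteq> 0"
  proof
    assume "Determinant.det A = 0"
    then obtain l where l: "\<exists>j\<le>n. l j \<noteq> 0" "\<And>i. i \<le> n \<Longrightarrow> (\<Sum>j\<le>n. A $$ (i, j) * l j) = 0"
      using det_zero_imp_kernel[OF A] by blast
    have "(\<Sum>j\<le>n. X i j * l j) = 0" if "i \<le> n" for i
      using l(2)[of i] that by (simp add: A_def)
    then have "\<forall>j\<le>n. l j = 0" by (rule ker)
    then show False using l(1) by blast
  qed
  define B where "B = (1 / Determinant.det A) \<cdot>\<^sub>m adj_mat A"
  have B: "B \<in> carrier_mat (Suc n) (Suc n)" using adj_mat(1)[OF A] by (simp add: B_def)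
  have AB: "A * B = 1\<^sub>m (Suc n)" "B * A = 1\<^sub>m (Suc n)"
    using adj_mat[OF A] A \<open>Determinant.det A \<noteq> 0\<close>
    by (auto simp: B_def mult_smult_distrib[OF A] mult_smult_assoc_mat[OF _ A] intro!: eq_matI)
  have prod: "(\<Sum>j\<le>n. C $$ (i, j) * D $$ (j, k)) = (C * D) $$ (i, k)"
    if "C \<in> carrier_mat (Suc n) (Suc n)" "D \<in> carrier_mat (Suc n) (Suc n)" "i \<le> n" "k \<le> n"
    for C D :: "'a mat" and i k
    using that by (simp add: scalar_prod_def atMost_atLeast0 atLeastLessThanSuc_atLeastAtMost del: sum.op_ivl_Suc)
  show ?thesis
  proof (rule that[of "\<lambda>i j. B $$ (i, j)"])
    fix i k assume "i \<le> n" "k \<le> n"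
    then show "(\<Sum>j\<le>n. X i j * B $$ (j, k)) = (if i = k then 1 else 0)"
      "(\<Sum>j\<le>n. B $$ (i, j) * X j k) = (if i = k then 1 else 0)"
      using prod[OF A B, of i k] prod[OF B A, of i k] unfolding AB by (simp_all add: A_def)
  qed
qed

section \<open>Conjugate permutations\<close>

text \<open>The periodicity of \<open>x\<close> makes \<open>f\<close> act on its orbit like a cycle of length \<open>d\<close>, all of whose points
  have the same period. So the number of points of the orbit fixed by a power of \<open>f\<close> depends on \<open>d\<close>
  alone.\<close>

lemma shortest_cycle:
  assumes fin: "finite S" and bij: "bij_betw f S S" and x: "x \<in> S"
    and per: "(f ^^ d) x = x" and pos: "0 < d" and least: "\<And>k. 0 < k \<Longrightarrow> k < d \<Longrightarrow> (f ^^ k) x \<noteq> x"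
  defines "C \<equiv> (\<lambda>i. (f ^^ i) x) ` {..<d}"
  shows "C \<subseteq> S" and "inj_on (\<lambda>i. (f ^^ i) x) {..<d}" and "bij_betw f C C"
    and "card {z \<in> C. (f ^^ k) z = z} = (if d dvd k then d else 0)"
proof -
  have pw: "bij_betw (f ^^ i) S S" for i by (rule bij_betw_funpow[OF bij])
  have in_S: "(f ^^ i) x \<in> S" for i using bij_betwE[OF pw] x by blast
  show CS: "C \<subseteq> S" using in_S by (auto simp: C_def)
  have cancel: "(f ^^ (i + k)) x = (f ^^ i) x \<longleftrightarrow> (f ^^ k) x = x" for i k
    using inj_on_eq_iff[OF bij_betw_imp_inj_on[OF pw[of i]] in_S[of k] x] by (simp add: funpow_add)
  show inj: "inj_on (\<lambda>i. (f ^^ i) x) {..<d}"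
  proof (rule linorder_inj_onI)
    fix i j assume "i < j" and "i \<in> {..<d}" and "j \<in> {..<d}"
    then show "(f ^^ i) x \<noteq> (f ^^ j) x"
      using cancel[of i "j - i"] least[of "j - i"] by auto
  qed auto
  have "f ` C \<subseteq> C"
  proof
    fix z assume "z \<in> f ` C"
    then obtain i where i: "i < d" "z = (f ^^ Suc i) x" by (auto simp: C_def)
    show "z \<in> C"
    proof (cases "Suc i < d")
      case True
      then show ?thesis unfolding C_def i(2) by (rule imageI[OF lessThan_iff[THEN iffD2]])
    next
      case False
      then have "Suc i = d" using i(1) by simp
      then have "z = (f ^^ 0) x" using per i(2) by simp
      then show ?thesis unfolding C_def using pos by blast
    qed
  qed
  moreover have "inj_on f C" by (rule inj_on_subset[OF bij_betw_imp_inj_on[OF bij] CS])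
  ultimately show "bij_betw f C C"
    unfolding bij_betw_def by (simp add: endo_inj_surj C_def)
  have fix_iff: "(f ^^ k) ((f ^^ i) x) = (f ^^ i) x \<longleftrightarrow> d dvd k" for i
  proof -
    have "(f ^^ k) ((f ^^ i) x) = (f ^^ (i + k)) x" by (metis add.commute comp_apply funpow_add)
    also have "\<dots> = (f ^^ i) x \<longleftrightarrow> (f ^^ k) x = x" by (rule cancel)
    also have "\<dots> \<longleftrightarrow> (f ^^ (k mod d)) x = x" using funpow_mod_eq[OF per, of k] by simp
    also have "\<dots> \<longleftrightarrow> k mod d = 0" using least[of "k mod d"] pos by (cases "k mod d = 0") auto
    finally show ?thesis by (simp add: dvd_eq_mod_eq_0)
  qed
  have "{z \<in> C. (f ^^ k) z = z} = (if d dvd k then C else {})"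
    using fix_iff by (auto simp: C_def)
  then show "card {z \<in> C. (f ^^ k) z = z} = (if d dvd k then d else 0)"
    using card_image[OF inj] by (simp add: C_def)
qed

text \<open>The smallest positive power with a fixed point is the same for \<open>f\<close> and \<open>g\<close>, because it can be read
  off from the counts. Its exponent is the length of a shortest cycle of either map. Matching one such
  cycle with another and deleting both lowers the two counts by the same amount, so induction on the
  number of points applies.\<close>

lemma equal_fixed_point_counts_imp_conjugate:
  assumes "finite S" "finite T" "bij_betw f S S" "bij_betw g T T"
    and "\<And>k. card {x \<in> S. (f ^^ k) x = x} = card {y \<in> T. (g ^^ k) y = y}"
  shows "\<exists>h. bij_betw h S T \<and> (\<forall>x\<in>S. h (f x) = g (h x))"
  using assms
proof (induction "card S" arbitrary: S T rule: less_induct)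
  case less
  note bijf = less.prems(3) and bijg = less.prems(4) and cnt = less.prems(5)
  show ?case
  proof (cases "S = {}")
    case True
    then have "T = {}" using cnt[of 0] less.prems(2) by simp
    then show ?thesis using True by (simp add: bij_betw_def)
  next
    case False
    \<comment> \<open>A power of \<open>f\<close> has a fixed point: the orbit of any point repeats, and \<open>f\<close> is injective.\<close>
    then obtain x0 where "x0 \<in> S" by blast
    have pw: "bij_betw (f ^^ i) S S" for i by (rule bij_betw_funpow[OF bijf])
    have "\<not> inj_on (\<lambda>i. (f ^^ i) x0) UNIV"
    proof
      assume "inj_on (\<lambda>i. (f ^^ i) x0) UNIV"
      moreover have "(\<lambda>i. (f ^^ i) x0) ` UNIV \<subseteq> S"
        using bij_betwE[OF pw] \<open>x0 \<in> S\<close> by blast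
      ultimately show False using less.prems(1) finite_subset finite_imageD infinite_UNIV_nat by blast
    qed
    then obtain i j where ij: "i < j" "(f ^^ i) x0 = (f ^^ j) x0"
      by (metis injI linorder_neqE_nat)
    have "(f ^^ i) ((f ^^ (j - i)) x0) = (f ^^ i) x0"
      using ij by (metis comp_apply funpow_add le_add_diff_inverse less_imp_le)
    moreover have "(f ^^ (j - i)) x0 \<in> S" using bij_betwE[OF pw] \<open>x0 \<in> S\<close> by blast
    ultimately have "(f ^^ (j - i)) x0 = x0"
      using bij_betw_imp_inj_on[OF pw[of i]] \<open>x0 \<in> S\<close> by (auto dest: inj_onD)
    then have ex: "\<exists>d. 0 < d \<and> (\<exists>x\<in>S. (f ^^ d) x = x)" using \<open>x0 \<in> S\<close> ij(1) by (intro exI[of _ "j - i"]) auto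
    define d where "d = (LEAST d. 0 < d \<and> (\<exists>x\<in>S. (f ^^ d) x = x))"
    have iff: "(\<exists>x\<in>S. (f ^^ k) x = x) \<longleftrightarrow> (\<exists>y\<in>T. (g ^^ k) y = y)" for k
    proof -
      have "{x \<in> S. (f ^^ k) x = x} = {} \<longleftrightarrow> {y \<in> T. (g ^^ k) y = y} = {}"
        using cnt[of k] card_0_eq[of "{x \<in> S. (f ^^ k) x = x}"] card_0_eq[of "{y \<in> T. (g ^^ k) y = y}"]
          less.prems(1,2) by simp
      then show ?thesis by blast
    qed
    have d: "0 < d" "\<exists>x\<in>S. (f ^^ d) x = x" using LeastI_ex[OF ex] unfolding d_def by auto
    have least: "\<not> (\<exists>x\<in>S. (f ^^ k) x = x)" if "0 < k" "k < d" for k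
      using not_less_Least[of k "\<lambda>d. 0 < d \<and> (\<exists>x\<in>S. (f ^^ d) x = x)"] that unfolding d_def by blast
    obtain x where x: "x \<in> S" "(f ^^ d) x = x" using d(2) by blast
    obtain y where y: "y \<in> T" "(g ^^ d) y = y" using d(2) iff by blast
    define C where "C = (\<lambda>i. (f ^^ i) x) ` {..<d}"
    define D where "D = (\<lambda>i. (g ^^ i) y) ` {..<d}"
    have lx: "(f ^^ k) x \<noteq> x" if "0 < k" "k < d" for k using least[OF that] x(1) by blast
    have ly: "(g ^^ k) y \<noteq> y" if "0 < k" "k < d" for k using least[OF that] iff y(1) by blast
    note C = shortest_cycle[OF less.prems(1) bijf x(1,2) d(1) lx, folded C_def]
    note D = shortest_cycle[OF less.prems(2) bijg y(1,2) d(1) ly, folded D_def]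
    have finC: "finite C" "finite D" by (auto simp: C_def D_def)
    have "\<exists>h. bij_betw h (S - C) (T - D) \<and> (\<forall>x\<in>S - C. h (f x) = g (h x))"
    proof (rule less.hyps)
      have "x \<in> C" using d(1) by (auto simp: C_def intro: image_eqI[where x = 0])
      then show "card (S - C) < card S" using x(1) less.prems(1) by (intro psubset_card_mono) auto
      show "bij_betw f (S - C) (S - C)" "bij_betw g (T - D) (T - D)"
        using C D bijf bijg by (auto intro: bij_betw_DiffI)
      show "card {x \<in> S - C. (f ^^ k) x = x} = card {y \<in> T - D. (g ^^ k) y = y}" for k
      proof -
        have "{x \<in> S - C. (f ^^ k) x = x} = {x \<in> S. (f ^^ k) x = x} - {x \<in> C. (f ^^ k) x = x}"
          "{y \<in> T - D. (g ^^ k) y = y} = {y \<in> T. (g ^^ k) y = y} - {y \<in> D. (g ^^ k) y = y}" by auto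
        moreover have "{x \<in> C. (f ^^ k) x = x} \<subseteq> {x \<in> S. (f ^^ k) x = x}"
          "{y \<in> D. (g ^^ k) y = y} \<subseteq> {y \<in> T. (g ^^ k) y = y}" using C(1) D(1) by auto
        ultimately show ?thesis using finC C(4) D(4) cnt by (simp add: card_Diff_subset)
      qed
    qed (use less.prems in auto)
    then obtain h where h: "bij_betw h (S - C) (T - D)" "\<And>x. x \<in> S - C \<Longrightarrow> h (f x) = g (h x)" by blast
    \<comment> \<open>The bijection of the two cycles that starts at \<open>x\<close> and \<open>y\<close>.\<close>
    define c where "c = (\<lambda>i. (g ^^ i) y) \<circ> inv_into {..<d} (\<lambda>i. (f ^^ i) x)"
    have c: "bij_betw c C D"
      unfolding c_def by (intro bij_betw_trans[OF bij_betw_inv_into])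
        (use C(2) D(2) in \<open>auto simp: bij_betw_def C_def D_def\<close>)
    have c_eq: "c ((f ^^ i) x) = (g ^^ i) y" if "i < d" for i
      using that inv_into_f_f[OF C(2)] by (simp add: c_def)
    have c_step: "c (f z) = g (c z)" if z: "z \<in> C" for z
    proof -
      obtain i where i: "i < d" "z = (f ^^ i) x" using z by (auto simp: C_def)
      show ?thesis
      proof (cases "Suc i < d")
        case True
        then show ?thesis using c_eq[of "Suc i"] c_eq[of i] i by simp
      next
        case False
        then have "Suc i = d" using i by simp
        then have "f z = x" "g ((g ^^ i) y) = y" using i x(2) y(2) by auto
        then show ?thesis using c_eq[of 0] c_eq[of i] i d(1) by simp
      qed
    qed
    let ?h = "\<lambda>z. if z \<in> C then c z else h z"
    have "bij_betw ?h (C \<union> (S - C)) (D \<union> (T - D))"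
    proof (rule bij_betw_combine)
      show "bij_betw ?h C D" using c by (rule bij_betw_cong[THEN iffD1, rotated]) auto
      show "bij_betw ?h (S - C) (T - D)" using h(1) by (rule bij_betw_cong[THEN iffD1, rotated]) auto
    qed auto
    moreover have "C \<union> (S - C) = S" "D \<union> (T - D) = T" using C(1) D(1) by auto
    moreover have "?h (f z) = g (?h z)" if "z \<in> S" for z
    proof (cases "z \<in> C")
      case True
      then show ?thesis using c_step bij_betwE[OF C(3)] by simp
    next
      case False
      then have "f z \<in> S - C" using that bij_betwE[OF bij_betw_DiffI[OF bijf C(3) C(1) C(1)]] by blast
      then show ?thesis using False h(2) that by simp
    qed
    ultimately show ?thesis by (intro exI[of _ ?h]) simp
  qed
qed

text \<open>The equivariance says that the invertible matrix \<open>A\<close> intertwines the permutation matrices of \<open>\<tau>1\<close>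
  and \<open>\<tau>2\<close>. The traces of their powers therefore agree, and such a trace counts fixed points.\<close>

lemma similar_permutation_matrices_imp_conjugate:
  fixes A B :: "nat \<Rightarrow> nat \<Rightarrow> 'a::field_char_0"
  assumes p: "\<tau>1 permutes {1..n}" and q: "\<tau>2 permutes {1..n}"
    and AB: "\<And>i k. i \<in> {1..n} \<Longrightarrow> k \<in> {1..n} \<Longrightarrow> (\<Sum>j=1..n. A i j * B j k) = (if i = k then 1 else 0)"
    and BA: "\<And>i k. i \<in> {1..n} \<Longrightarrow> k \<in> {1..n} \<Longrightarrow> (\<Sum>j=1..n. B i j * A j k) = (if i = k then 1 else 0)"
    and eqv: "\<And>i j. i \<in> {1..n} \<Longrightarrow> j \<in> {1..n} \<Longrightarrow> A (\<tau>2 i) (\<tau>1 j) = A i j"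
  obtains \<sigma> where "bij_betw \<sigma> {1..n} {1..n}" "\<And>i. i \<in> {1..n} \<Longrightarrow> \<sigma> (\<tau>1 i) = \<tau>2 (\<sigma> i)"
proof -
  have pw: "bij_betw (\<tau>1 ^^ k) {1..n} {1..n}" "bij_betw (\<tau>2 ^^ k) {1..n} {1..n}" for k
    using permutes_imp_bij[OF p] permutes_imp_bij[OF q] by (auto intro: bij_betw_funpow)
  have pw_in: "(\<tau>1 ^^ k) i \<in> {1..n}" "(\<tau>2 ^^ k) i \<in> {1..n}" if "i \<in> {1..n}" for i k
    using bij_betwE[OF pw(1)[of k]] bij_betwE[OF pw(2)[of k]] that by blast+
  have eqvk: "A ((\<tau>2 ^^ k) i) ((\<tau>1 ^^ k) j) = A i j" if "i \<in> {1..n}" "j \<in> {1..n}" for i j k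
    using that by (induction k) (simp_all add: eqv[OF pw_in(2) pw_in(1)] del: atLeastAtMost_iff)
  have "card {i \<in> {1..n}. (\<tau>1 ^^ k) i = i} = card {i \<in> {1..n}. (\<tau>2 ^^ k) i = i}" for k
  proof -
    have "of_nat (card {i \<in> {1..n}. (\<tau>2 ^^ k) i = i}) = (\<Sum>i=1..n. if (\<tau>2 ^^ k) i = i then 1 else (0::'a))"
      by (simp add: sum.If_cases Int_def)
    also have "\<dots> = (\<Sum>i=1..n. \<Sum>j=1..n. A ((\<tau>2 ^^ k) i) j * B j i)"
      by (rule sum.cong[OF HOL.refl], rule AB[OF pw_in(2), symmetric])
    also have "\<dots> = (\<Sum>i=1..n. \<Sum>j=1..n. A ((\<tau>2 ^^ k) i) ((\<tau>1 ^^ k) j) * B ((\<tau>1 ^^ k) j) i)"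
      by (rule sum.cong[OF HOL.refl], rule sum.reindex_bij_betw[OF pw(1), symmetric])
    also have "\<dots> = (\<Sum>i=1..n. \<Sum>j=1..n. B ((\<tau>1 ^^ k) j) i * A i j)"
      by (intro sum.cong HOL.refl) (simp add: eqvk)
    also have "\<dots> = (\<Sum>j=1..n. \<Sum>i=1..n. B ((\<tau>1 ^^ k) j) i * A i j)"
      by (rule sum.swap)
    also have "\<dots> = (\<Sum>i=1..n. if (\<tau>1 ^^ k) i = i then 1 else 0)"
      by (rule sum.cong[OF HOL.refl], rule BA[OF pw_in(1)])
    also have "\<dots> = of_nat (card {i \<in> {1..n}. (\<tau>1 ^^ k) i = i})"
      by (simp add: sum.If_cases Int_def)
    finally show ?thesis by (simp only: of_nat_eq_iff)
  qed
  from equal_fixed_point_counts_imp_conjugate[OF _ _ permutes_imp_bij[OF p] permutes_imp_bij[OF q] this]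
  show ?thesis using that by auto
qed

text \<open>Here row \<open>i\<close> of \<open>X\<close> contains the linear part of the image of the \<open>i\<close>-th generator, where index \<open>0\<close>
  stands for the red edge and \<open>1, \<dots>, n\<close> for the blue ones. The two families of equations compare the
  coefficients of two blue letters, and of one blue and one red letter, in \<open>x\<^sub>i y = y x\<^bsub>\<tau>2(i)\<^esub>\<close>. If \<open>y\<close>
  had a nonzero blue part \<open>b\<close>, the first family would make the blue part of each \<open>x\<^sub>i\<close> a multiple of
  \<open>b\<close>, and for \<open>n \<ge> 2\<close> some nonzero functional would kill all rows. Once the blue part of \<open>y\<close>
  vanishes, the second family is equivariance of the blue block of \<open>X\<close>.\<close>

lemma quadratic_relations_imp_conjugate:
  fixes X :: "nat \<Rightarrow> nat \<Rightarrow> 'a::field_char_0"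
  assumes p1: "\<tau>1 permutes {1..n}" and p2: "\<tau>2 permutes {1..n}" and n: "2 \<le> n"
    and ker: "\<And>l. (\<And>i. i \<le> n \<Longrightarrow> (\<Sum>j\<le>n. X i j * l j) = 0) \<Longrightarrow> \<forall>j\<le>n. l j = 0"
    and blue: "\<And>i j k. i \<in> {1..n} \<Longrightarrow> j \<in> {1..n} \<Longrightarrow> k \<in> {1..n} \<Longrightarrow>
      X i j * X 0 k = X 0 j * X (\<tau>2 i) k"
    and mixed: "\<And>i j. i \<in> {1..n} \<Longrightarrow> j \<in> {1..n} \<Longrightarrow>
      X i 0 * X 0 (\<tau>1 j) + X i j * X 0 0 = X 0 0 * X (\<tau>2 i) (\<tau>1 j) + X 0 j * X (\<tau>2 i) 0"
  obtains \<sigma> where "bij_betw \<sigma> {1..n} {1..n}" "\<And>i. i \<in> {1..n} \<Longrightarrow> \<sigma> (\<tau>1 i) = \<tau>2 (\<sigma> i)"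
proof -
  have tau_in: "\<tau>1 i \<in> {1..n}" "\<tau>2 i \<in> {1..n}" if "i \<in> {1..n}" for i
    by (simp_all only: permutes_in_image[OF p1] permutes_in_image[OF p2] that)
  have X0: "X 0 k = 0" if k: "k \<in> {1..n}" for k
  proof (rule ccontr)
    assume nz: "X 0 k \<noteq> 0"
    define m where "m = (if k = 1 then 2 else 1 :: nat)"
    have m: "m \<in> {1..n}" "m \<noteq> k" using n by (auto simp: m_def)
    \<comment> \<open>A nonzero functional that vanishes on the red generator and on the blue part of row \<open>0\<close>.\<close>
    define l where "l j = (if j = m then X 0 k else if j = k then - X 0 m else 0)" for j
    have "(\<Sum>j\<le>n. X i j * l j) = 0" if "i \<le> n" for i
    proof -
      have "(\<Sum>j\<le>n. X i j * l j) = (\<Sum>j\<in>{m, k}. X i j * l j)"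
        using m k by (intro sum.mono_neutral_right) (auto simp: l_def)
      also have "\<dots> = X i m * X 0 k - X i k * X 0 m"
        using m by (simp add: l_def)
      also have "\<dots> = 0"
      proof (cases "i = 0")
        case False
        then have i: "i \<in> {1..n}" using that by simp
        have "X i k = X (\<tau>2 i) k" using blue[OF i k k] nz by simp
        then show ?thesis using blue[OF i m(1) k] by simp
      qed simp
      finally show ?thesis .
    qed
    then have "\<forall>j\<le>n. l j = 0" by (rule ker)
    then show False using m nz by (auto simp: l_def)
  qed
  obtain Z where XZ: "\<And>i k. i \<le> n \<Longrightarrow> k \<le> n \<Longrightarrow> (\<Sum>j\<le>n. X i j * Z j k) = (if i = k then 1 else 0)"
    and ZX: "\<And>i k. i \<le> n \<Longrightarrow> k \<le> n \<Longrightarrow> (\<Sum>j\<le>n. Z i j * X j k) = (if i = k then 1 else 0)"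
    using trivial_kernel_imp_inverse[OF ker] by blast
  have split: "(\<Sum>j\<le>n. h j) = h 0 + (\<Sum>j=1..n. h j)" for h :: "nat \<Rightarrow> 'a"
    by (simp add: atMost_atLeast0 sum.atLeast_Suc_atMost)
  have row0: "(\<Sum>j\<le>n. X 0 j * Z j k) = X 0 0 * Z 0 k" for k
    unfolding split using X0 by simp
  have nz: "X 0 0 \<noteq> 0" using XZ[of 0 0] row0[of 0] by auto
  \<comment> \<open>The inverse is block triangular too, so its blue block inverts the blue block of \<open>X\<close>.\<close>
  have Z0: "Z 0 k = 0" if "k \<in> {1..n}" for k using XZ[of 0 k] row0[of k] nz that by auto
  show ?thesis
  proof (rule similar_permutation_matrices_imp_conjugate[OF p1 p2, where A = X and B = Z])
    fix i k assume i: "i \<in> {1..n}" and k: "k \<in> {1..n}"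
    then show "(\<Sum>j=1..n. X i j * Z j k) = (if i = k then 1 else 0)"
      using XZ[of i k] Z0[OF k] unfolding split by simp
    show "(\<Sum>j=1..n. Z i j * X j k) = (if i = k then 1 else 0)"
      using ZX[of i k] X0[OF k] i k unfolding split by simp
    show "X (\<tau>2 i) (\<tau>1 k) = X i k"
      using mixed[OF i k] X0[OF k] X0[OF tau_in(1)[OF k]] nz by simp
  qed (use that in blast)
qed

section \<open>Generated operator algebras in a topology with continuous coordinates\<close>

text \<open>One construction covers both algebras: the norm topology yields \<open>A_alg\<close> and the weak operator
  topology yields \<open>L_alg\<close>.\<close>

definition generated_algebra :: "'a ell2_op topology \<Rightarrow> ('a, 'm) monoid_scheme \<Rightarrow> 'a ell2_op set" where
  "generated_algebra X M = (\<lambda>B. op_subalgebra B \<and> closedin X B) hull (creation M ` carrier M)"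

text \<open>The common feature of the two topologies that makes convolution identities survive limits.\<close>

definition coordinate_continuous :: "'a ell2_op topology \<Rightarrow> bool" where
  "coordinate_continuous X \<longleftrightarrow> topspace X = UNIV \<and>
     (\<forall>x u. continuous_map X euclidean (\<lambda>T. coord (blinfun_apply T x) u))"

lemma A_alg_eq: "A_alg M = generated_algebra euclidean M"
  by (simp add: A_alg_def generated_algebra_def)

lemma L_alg_eq: "L_alg M = generated_algebra weak_operator_topology M"
  by (simp add: L_alg_def generated_algebra_def)

lemma coord_ket: "coord (ket v) u = (if u = v then 1 else 0)"
  by (simp add: ket.rep_eq)

lemma cinner_ket: "cinner x (ket u) = coord x u"
proof -
  have "infsum (\<lambda>i. coord x i * cnj (coord (ket u) i)) UNIV = infsum (\<lambda>i. coord x i * cnj (coord (ket u) i)) {u}"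
    by (rule infsum_cong_neutral) (auto simp: coord_ket)
  then show ?thesis by (simp add: cinner.rep_eq coord_ket)
qed

lemma coord_cscale: "coord (cscale c x) u = c * coord x u"
  by (simp add: cscale.rep_eq)

lemma ell2_eqI: "(\<And>u. coord x u = coord y u) \<Longrightarrow> x = y"
  by (simp add: coord_inject[symmetric] fun_eq_iff)

lemma bounded_linear_coord: "bounded_linear (\<lambda>x. coord x u)"
  by (rule bounded_linear_intro[where K = 1])
    (simp_all add: coord_add coord_scaleR scaleR_conv_of_real cmod_coord_le)

lemma coordinate_continuous_euclidean: "coordinate_continuous euclidean"
  unfolding coordinate_continuous_def continuous_map_iff_continuous2
  by (auto intro!: linear_continuous_on bounded_linear_compose[OF bounded_linear_coord]
      blinfun.bounded_linear_left)

lemma continuous_map_weak_operator_cinner: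
  "continuous_map weak_operator_topology euclidean (\<lambda>T. cinner (blinfun_apply T x) y)"
proof -
  have "continuous_map weak_operator_topology euclidean
      ((\<lambda>F. F (x, y)) \<circ> (\<lambda>T (x, y). cinner (blinfun_apply T x) y))"
    unfolding weak_operator_topology_def
    by (intro continuous_map_pullback) (simp add: continuous_on_product_coordinates)
  then show ?thesis by (simp add: o_def)
qed

lemma topspace_weak_operator_topology: "topspace weak_operator_topology = UNIV"
  by (simp add: weak_operator_topology_def topspace_pullback_topology)

lemma coordinate_continuous_weak_operator: "coordinate_continuous weak_operator_topology"
  using continuous_map_weak_operator_cinner[where y = "ket _"]
  by (auto simp: coordinate_continuous_def cinner_ket topspace_weak_operator_topology)

lemma continuous_map_complex_mult_left:
  "continuous_map X euclidean f \<Longrightarrow> continuous_map X euclidean (\<lambda>x. c * f x :: complex)"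
  by (simp add: continuous_map_atin tendsto_mult_left)

lemma continuous_map_complex_mult_right:
  "continuous_map X euclidean f \<Longrightarrow> continuous_map X euclidean (\<lambda>x. f x * c :: complex)"
  by (simp add: continuous_map_atin tendsto_mult_right)

lemma closedin_zero_set:
  assumes "continuous_map X euclidean f" "topspace X = UNIV"
  shows "closedin X {T. f T = (0::complex)}"
proof -
  have "closedin X {T \<in> topspace X. f T \<in> {0}}"
    by (rule closedin_continuous_map_preimage[OF assms(1)]) simp
  then show ?thesis by (simp add: assms(2))
qed

context
  fixes X :: "'a ell2_op topology" and M :: "('a, 'm) monoid_scheme"
  assumes X: "coordinate_continuous X"
begin

lemma generated_algebra_closed:
  "op_subalgebra (generated_algebra X M)" "closedin X (generated_algebra X M)"
proof -
  have "(\<lambda>B. op_subalgebra B \<and> closedin X B) (generated_algebra X M)"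
    unfolding generated_algebra_def
  proof (rule hull_in)
    fix F assume F: "\<forall>B\<in>F. op_subalgebra B \<and> closedin X B"
    have "closedin X (\<Inter>F)"
    proof (cases "F = {}")
      case True
      then show ?thesis using X closedin_topspace[of X] by (simp add: coordinate_continuous_def)
    qed (use F in auto)
    moreover have "op_subalgebra (\<Inter>F)" using F by (simp add: op_subalgebra_def)
    ultimately show "op_subalgebra (\<Inter>F) \<and> closedin X (\<Inter>F)" by simp
  qed
  then show "op_subalgebra (generated_algebra X M)" "closedin X (generated_algebra X M)" by auto
qed

lemma creation_in_generated_algebra: "v \<in> carrier M \<Longrightarrow> creation M v \<in> generated_algebra X M"
  unfolding generated_algebra_def using hull_subset by fast

lemma generated_algebra_minimal:
  assumes "op_subalgebra B" "closedin X B" "\<And>v. v \<in> carrier M \<Longrightarrow> creation M v \<in> B"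
  shows "generated_algebra X M \<subseteq> B"
  unfolding generated_algebra_def by (rule hull_minimal) (use assms in auto)

end

section \<open>Left convolution operators\<close>

definition factorizations :: "('a, 'm) monoid_scheme \<Rightarrow> 'a \<Rightarrow> ('a \<times> 'a) set" where
  "factorizations M u = {(w, v). w \<in> carrier M \<and> v \<in> carrier M \<and> w \<otimes>\<^bsub>M\<^esub> v = u}"

text \<open>The convolution runs over the finitely many factorisations of \<open>u\<close>. The operators \<open>L\<^sub>v\<close> are the
  convolutions with basis vectors.\<close>

definition left_convolution :: "('a, 'm) monoid_scheme \<Rightarrow> 'a ell2_op \<Rightarrow> bool" where
  "left_convolution M T \<longleftrightarrow> (\<forall>x u. coord (T x) u =
     (\<Sum>(w, v)\<in>factorizations M u. coord (T (ket \<one>\<^bsub>M\<^esub>)) w * coord x v))"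

lemma left_convolutionD:
  "left_convolution M T \<Longrightarrow> coord (blinfun_apply T x) u =
     (\<Sum>a\<in>factorizations M u. coord (T (ket \<one>\<^bsub>M\<^esub>)) (fst a) * coord x (snd a))"
  unfolding left_convolution_def case_prod_unfold by blast

lemma left_convolutionI:
  "(\<And>x u. coord (blinfun_apply T x) u =
     (\<Sum>a\<in>factorizations M u. coord (T (ket \<one>\<^bsub>M\<^esub>)) (fst a) * coord x (snd a))) \<Longrightarrow> left_convolution M T"
  unfolding left_convolution_def case_prod_unfold by blast

locale finitely_factorizable_monoid = Group.monoid M for M :: "('a, 'm) monoid_scheme" (structure) +
  assumes left_cancel: "v \<in> carrier M \<Longrightarrow> inj_on (\<lambda>w. v \<otimes> w) (carrier M)"
    and finite_factorizations: "finite (factorizations M u)"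
begin

lemma left_convolution_creation:
  assumes v: "v \<in> carrier M" shows "left_convolution M (creation M v)"
  unfolding left_convolution_def
proof (intro allI)
  fix x u
  have "(\<Sum>(w, y)\<in>factorizations M u. coord (creation M v (ket \<one>)) w * coord x y) =
      (\<Sum>(w, y)\<in>factorizations M u. if w = v then coord x y else 0)"
    using creation_ket[OF left_cancel[OF v] one_closed] v
    by (intro sum.cong HOL.refl) (auto simp: coord_ket)
  also have "\<dots> = coord (creation M v x) u"
  proof (cases "u \<in> (\<lambda>w. v \<otimes> w) ` carrier M")
    case True
    then obtain y where y: "y \<in> carrier M" "u = v \<otimes> y" by blast
    then have "(\<Sum>(w, y)\<in>factorizations M u. if w = v then coord x y else 0) =
        (\<Sum>(w, y)\<in>{(v, y)}. if w = v then coord x y else 0)"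
      using v left_cancel[OF v]
      by (intro sum.mono_neutral_right finite_factorizations)
        (auto simp: factorizations_def inj_on_eq_iff split: if_splits)
    then show ?thesis
      using y left_cancel[OF v] by (simp add: creation_coord shift_def)
  next
    case False
    then have "(\<Sum>(w, y)\<in>factorizations M u. if w = v then coord x y else 0) = 0"
      by (intro sum.neutral) (auto simp: factorizations_def)
    then show ?thesis
      using False left_cancel[OF v] by (simp add: creation_coord shift_def)
  qed
  finally show "coord (creation M v x) u =
      (\<Sum>(w, y)\<in>factorizations M u. coord (creation M v (ket \<one>)) w * coord x y)" ..
qed

text \<open>Associativity: both sides are sums over the factorisations of \<open>u\<close> into three factors, bracketed in the
  two possible ways.\<close>

lemma left_convolution_compose:
  assumes S: "left_convolution M S" and T: "left_convolution M T"
  shows "left_convolution M (S o\<^sub>L T)"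
proof (rule left_convolutionI)
  fix x u
  let ?s = "coord (S (ket \<one>))" and ?t = "coord (T (ket \<one>))"
  let ?F = "factorizations M"
  have "coord ((S o\<^sub>L T) x) u = (\<Sum>a\<in>?F u. ?s (fst a) * coord (T x) (snd a))"
    by (simp add: left_convolutionD[OF S, of "T x"])
  also have "\<dots> = (\<Sum>a\<in>?F u. \<Sum>b\<in>?F (snd a). ?s (fst a) * (?t (fst b) * coord x (snd b)))"
    by (simp add: left_convolutionD[OF T, of x] sum_distrib_left)
  also have "\<dots> = (\<Sum>(a, b)\<in>(SIGMA a:?F u. ?F (snd a)). ?s (fst a) * (?t (fst b) * coord x (snd b)))"
    by (rule sum.Sigma) (auto simp: finite_factorizations)
  also have "\<dots> = (\<Sum>(a, b)\<in>(SIGMA a:?F u. ?F (fst a)). ?s (fst b) * ?t (snd b) * coord x (snd a))"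
    by (rule sum.reindex_bij_witness[
          where i = "\<lambda>(a, b). ((fst b, snd b \<otimes> snd a), (snd b, snd a))"
            and j = "\<lambda>(a, b). ((fst a \<otimes> fst b, snd b), (fst a, fst b))"])
      (auto simp: factorizations_def m_assoc)
  also have "\<dots> = (\<Sum>a\<in>?F u. \<Sum>b\<in>?F (fst a). ?s (fst b) * ?t (snd b) * coord x (snd a))"
    by (rule sum.Sigma[symmetric]) (auto simp: finite_factorizations)
  also have "\<dots> = (\<Sum>a\<in>?F u. coord ((S o\<^sub>L T) (ket \<one>)) (fst a) * coord x (snd a))"
    by (simp add: left_convolutionD[OF S, of "T (ket \<one>)"] sum_distrib_right)
  finally show "coord ((S o\<^sub>L T) x) u =
      (\<Sum>a\<in>?F u. coord ((S o\<^sub>L T) (ket \<one>)) (fst a) * coord x (snd a))" .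
qed

lemma op_subalgebra_left_convolution: "op_subalgebra {T. left_convolution M T}"
proof -
  have "left_convolution M 0" by (simp add: left_convolution_def zero_ell2.rep_eq)
  moreover have "left_convolution M (S + T)" if S: "left_convolution M S" and T: "left_convolution M T" for S T
  proof (rule left_convolutionI)
    show "coord ((S + T) x) u =
        (\<Sum>a\<in>factorizations M u. coord ((S + T) (ket \<one>)) (fst a) * coord x (snd a))" for x u
      unfolding blinfun.add_left coord_add left_convolutionD[OF S, of x] left_convolutionD[OF T, of x]
      by (simp add: distrib_right sum.distrib)
  qed
  moreover have "left_convolution M (cscale_op c T)" if T: "left_convolution M T" for c T
  proof (rule left_convolutionI)
    show "coord (cscale_op c T x) u =
        (\<Sum>a\<in>factorizations M u. coord (cscale_op c T (ket \<one>)) (fst a) * coord x (snd a))" for x u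
      unfolding cscale_op_apply coord_cscale left_convolutionD[OF T, of x]
      by (simp add: sum_distrib_left mult.assoc)
  qed
  ultimately show ?thesis using left_convolution_compose by (simp add: op_subalgebra_def)
qed

text \<open>For fixed \<open>x\<close> and \<open>u\<close> the convolution identity involves only finitely many coordinates, each of
  which depends continuously on the operator.\<close>

lemma closedin_left_convolution:
  assumes X: "coordinate_continuous X" shows "closedin X {T. left_convolution M T}"
proof -
  let ?d = "\<lambda>x u T. coord (blinfun_apply T x) u -
    (\<Sum>(w, v)\<in>factorizations M u. coord (blinfun_apply T (ket \<one>)) w * coord x v)"
  have "closedin X {T. ?d x u T = 0}" for x u
  proof (rule closedin_zero_set)
    show "continuous_map X euclidean (?d x u)"
      using X unfolding coordinate_continuous_def case_prod_unfold
      by (intro continuous_map_diff continuous_map_sum continuous_map_complex_mult_right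
          finite_factorizations) auto
  qed (use X in \<open>simp add: coordinate_continuous_def\<close>)
  then have "closedin X (\<Inter>((\<lambda>(x, u). {T. ?d x u T = 0}) ` UNIV))"
    by (intro closedin_Inter) auto
  moreover have "\<Inter>((\<lambda>(x, u). {T. ?d x u T = 0}) ` UNIV) = {T. left_convolution M T}"
    by (auto simp: left_convolution_def)
  ultimately show ?thesis by simp
qed

lemma generated_algebra_left_convolution:
  assumes "coordinate_continuous X" "T \<in> generated_algebra X M" shows "left_convolution M T"
  using generated_algebra_minimal[OF assms(1) op_subalgebra_left_convolution
      closedin_left_convolution[OF assms(1)]] left_convolution_creation assms(2) by blast

end

context finitely_factorizable_monoid
begin

lemma left_convolution_eqI:
  assumes "left_convolution M S" "left_convolution M T" "S (ket \<one>) = T (ket \<one>)"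
  shows "S = T"
proof (rule blinfun_eqI, rule ell2_eqI)
  fix x u
  show "coord (S x) u = coord (T x) u"
    unfolding left_convolutionD[OF assms(1), of x] left_convolutionD[OF assms(2), of x] assms(3) ..
qed

lemma left_convolution_fock:
  assumes "left_convolution M T" shows "T x \<in> fock M"
  unfolding fock_def
proof clarify
  fix u assume "u \<notin> carrier M"
  then have "factorizations M u = {}" by (auto simp: factorizations_def)
  then show "coord (T x) u = 0" by (simp add: left_convolutionD[OF assms, of x])
qed

lemma creation_one_fock: "x \<in> fock M \<Longrightarrow> creation M \<one> x = x"
proof (rule ell2_eqI)
  fix u assume x: "x \<in> fock M"
  have "inj_on (\<lambda>w. \<one> \<otimes> w) (carrier M)" by (rule left_cancel[OF one_closed])
  then show "coord (creation M \<one> x) u = coord x u"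
    using x by (auto simp: creation_coord shift_def fock_def intro!: arg_cong[where f = "coord x"] inv_into_f_eq)
qed

lemma creation_one_compose: "left_convolution M T \<Longrightarrow> creation M \<one> o\<^sub>L T = T"
  by (rule blinfun_eqI) (simp add: creation_one_fock left_convolution_fock)

lemma creation_mult:
  assumes "v \<in> carrier M" "w \<in> carrier M"
  shows "creation M (v \<otimes> w) = creation M v o\<^sub>L creation M w"
proof (rule left_convolution_eqI)
  show "creation M (v \<otimes> w) (ket \<one>) = (creation M v o\<^sub>L creation M w) (ket \<one>)"
    using assms by (simp add: creation_ket left_cancel)
qed (use assms in \<open>auto intro: left_convolution_creation left_convolution_compose\<close>)

end

section \<open>Factorisations in the semigroup of a 2-graph\<close>

definition word_class :: "nat \<Rightarrow> (nat \<Rightarrow> nat) \<Rightarrow> edge list \<Rightarrow> edge list set" where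
  "word_class n \<tau> w = two_graph_rel n \<tau> `` {w}"

lemma length_normal_form: "fst (normal_form \<tau> w) + length (snd (normal_form \<tau> w)) = length w"
proof -
  have "fst (nf_act \<tau> a p) + length (snd (nf_act \<tau> a p)) = Suc (fst p + length (snd p))" for a p
    by (cases a; cases p) auto
  then show ?thesis by (induction w) (simp_all add: normal_form_def)
qed

context
  fixes n :: nat and \<tau> :: "nat \<Rightarrow> nat"
  assumes perm: "\<tau> permutes {1..n}"
begin

lemma word_class_eq_iff:
  "\<lbrakk>u \<in> words n; v \<in> words n\<rbrakk> \<Longrightarrow>
    word_class n \<tau> u = word_class n \<tau> v \<longleftrightarrow> normal_form \<tau> u = normal_form \<tau> v"
  unfolding word_class_def eq_equiv_class_iff[OF equiv_two_graph_rel[OF perm]]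
  by (rule two_graph_rel_iff[OF perm])

lemma word_class_carrier: "w \<in> words n \<Longrightarrow> word_class n \<tau> w \<in> carrier (two_graph n \<tau>)"
  using two_graph_class_in_carrier[OF perm] by (simp add: word_class_def)

lemma word_classE:
  assumes "x \<in> carrier (two_graph n \<tau>)"
  obtains w where "w \<in> words n" "x = word_class n \<tau> w"
  using two_graph_carrierE[OF perm assms] that unfolding word_class_def by blast

lemma word_class_mult:
  "\<lbrakk>u \<in> words n; v \<in> words n\<rbrakk> \<Longrightarrow>
    word_class n \<tau> u \<otimes>\<^bsub>two_graph n \<tau>\<^esub> word_class n \<tau> v = word_class n \<tau> (u @ v)"
  using two_graph_mult[OF perm] by (simp add: word_class_def)

lemma one_two_graph: "\<one>\<^bsub>two_graph n \<tau>\<^esub> = word_class n \<tau> []"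
  by (simp add: two_graph_def word_class_def)

lemma word_class_conv:
  assumes u: "u \<in> words n"
  shows "word_class n \<tau> u = {w \<in> words n. normal_form \<tau> w = normal_form \<tau> u}"
proof -
  have "(u, w) \<in> two_graph_rel n \<tau> \<longleftrightarrow> w \<in> words n \<and> normal_form \<tau> w = normal_form \<tau> u" for w
    using two_graph_rel_iff[OF perm u, of w] two_graph_rel_words[OF perm, of u w] by metis
  then show ?thesis by (simp add: word_class_def Image_singleton)
qed

text \<open>The factorisations of a class are the ways of cutting one of its words in two. Together with the explicit
  classes of short words this gives the Cauchy products in degrees one and two; the only short class
  with two words comes from the defining relation.\<close>

lemma factorizations_word_class:
  assumes u: "u \<in> words n"
  shows "factorizations (two_graph n \<tau>) (word_class n \<tau> u) =
    (\<Union>w\<in>word_class n \<tau> u. (\<lambda>i. (word_class n \<tau> (take i w), word_class n \<tau> (drop i w))) ` {..length w})"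
    (is "?L = ?R")
proof
  show "?L \<subseteq> ?R"
  proof
    fix a assume "a \<in> ?L"
    then obtain x y where a: "a = (x, y)" "x \<in> carrier (two_graph n \<tau>)" "y \<in> carrier (two_graph n \<tau>)"
      "x \<otimes>\<^bsub>two_graph n \<tau>\<^esub> y = word_class n \<tau> u" by (auto simp: factorizations_def)
    obtain p where p: "p \<in> words n" "x = word_class n \<tau> p" using a(2) by (rule word_classE)
    obtain q where q: "q \<in> words n" "y = word_class n \<tau> q" using a(3) by (rule word_classE)
    note pq = p(1) q(1) p(2) q(2)
    have "word_class n \<tau> (p @ q) = word_class n \<tau> u"
      using a(4) pq by (simp add: word_class_mult)
    then have "p @ q \<in> word_class n \<tau> u"
      using pq(1,2) u by (simp add: word_class_eq_iff) (simp add: word_class_conv)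
    then show "a \<in> ?R"
      using a(1) pq by (intro UN_I[where a = "p @ q"] image_eqI[where x = "length p"]) auto
  qed
  show "?R \<subseteq> ?L"
  proof
    fix a assume "a \<in> ?R"
    then obtain w i where w: "w \<in> words n" "normal_form \<tau> w = normal_form \<tau> u"
      and a: "a = (word_class n \<tau> (take i w), word_class n \<tau> (drop i w))"
      using u by (auto simp: word_class_conv)
    have "take i w \<in> words n" "drop i w \<in> words n"
      using w(1) words_append[of "take i w" "drop i w" n] by simp_all
    then show "a \<in> ?L"
      using w u a by (simp add: factorizations_def word_class_carrier word_class_mult word_class_eq_iff)
  qed
qed

lemma length_in_word_class:
  assumes "u \<in> words n" "w \<in> word_class n \<tau> u" shows "length w = length u"
proof -
  have "normal_form \<tau> w = normal_form \<tau> u" using assms by (simp add: word_class_conv)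
  then show ?thesis by (metis length_normal_form)
qed

lemma finitely_factorizable_two_graph: "finitely_factorizable_monoid (two_graph n \<tau>)"
proof (rule finitely_factorizable_monoid.intro[OF monoid_two_graph[OF perm]],
    rule finitely_factorizable_monoid_axioms.intro)
  show "inj_on (\<lambda>w. v \<otimes>\<^bsub>two_graph n \<tau>\<^esub> w) (carrier (two_graph n \<tau>))"
    if "v \<in> carrier (two_graph n \<tau>)" for v by (rule two_graph_left_cancel[OF perm that])
  show "finite (factorizations (two_graph n \<tau>) x)" for x
  proof (cases "x \<in> carrier (two_graph n \<tau>)")
    case True
    then obtain u where u: "u \<in> words n" "x = word_class n \<tau> u" by (rule word_classE)
    have "word_class n \<tau> u \<subseteq> {w. set w \<subseteq> insert Red (Blue ` {1..n}) \<and> length w = length u}"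
    proof
      fix w assume w: "w \<in> word_class n \<tau> u"
      then have "w \<in> words n" using word_class_conv[OF u(1)] by simp
      then have "set w \<subseteq> insert Red (Blue ` {1..n})" unfolding words_def lists_eq_set by simp
      then show "w \<in> {w. set w \<subseteq> insert Red (Blue ` {1..n}) \<and> length w = length u}"
        using length_in_word_class[OF u(1) w] by simp
    qed
    moreover have "finite {w. set w \<subseteq> insert Red (Blue ` {1..n}) \<and> length w = length u}"
      by (intro finite_lists_length_eq) simp
    ultimately have "finite (word_class n \<tau> u)" by (rule finite_subset)
    then show ?thesis unfolding u(2) factorizations_word_class[OF u(1)]
      by (intro finite_UN_I finite_imageI) simp_all
  next
    case False
    then have "factorizations (two_graph n \<tau>) x = {}"
      using monoid.m_closed[OF monoid_two_graph[OF perm]] by (auto simp: factorizations_def)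
    then show ?thesis by simp
  qed
qed

lemma word_class_short:
  shows "word_class n \<tau> [] = {[]}"
    and "a \<in> insert Red (Blue ` {1..n}) \<Longrightarrow> word_class n \<tau> [a] = {[a]}"
    and "i \<in> {1..n} \<Longrightarrow> j \<in> {1..n} \<Longrightarrow> word_class n \<tau> [Blue i, Blue j] = {[Blue i, Blue j]}"
    and "i \<in> {1..n} \<Longrightarrow> word_class n \<tau> [Blue i, Red] = {[Blue i, Red], [Red, Blue (\<tau> i)]}"
proof -
  have rep: "w \<in> word_class n \<tau> w" if "w \<in> words n" for w using that by (simp add: word_class_conv)
  have len: "length w = length u \<and> normal_form \<tau> w = normal_form \<tau> u"
    if "u \<in> words n" "w \<in> word_class n \<tau> u" for u w
    using length_in_word_class[OF that] that(2) word_class_conv[OF that(1)] by blast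
  have "w = []" if "w \<in> word_class n \<tau> []" for w using len[OF words_Nil that] by simp
  then show "word_class n \<tau> [] = {[]}" using rep[of "[]"] words_Nil by blast
  show "word_class n \<tau> [a] = {[a]}" if "a \<in> insert Red (Blue ` {1..n})"
  proof -
    have a: "[a] \<in> words n" using that by simp
    have "w = [a]" if w: "w \<in> word_class n \<tau> [a]" for w
    proof -
      obtain b where "w = [b]" using len[OF a w] by (auto simp: length_Suc_conv)
      then show ?thesis using len[OF a w] by (cases a; cases b) (auto simp: normal_form_def)
    qed
    then show ?thesis using rep[OF a] by blast
  qed
  have two: "\<exists>b c. w = [b, c]" if "length w = length [x, y]" for w :: "edge list" and x y :: edge
    using that by (auto simp: length_Suc_conv)
  show "word_class n \<tau> [Blue i, Blue j] = {[Blue i, Blue j]}" if "i \<in> {1..n}" "j \<in> {1..n}"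
  proof -
    have u: "[Blue i, Blue j] \<in> words n" using that by simp
    have "w = [Blue i, Blue j]" if w: "w \<in> word_class n \<tau> [Blue i, Blue j]" for w
    proof -
      obtain b c where "w = [b, c]" using len[OF u w] two by blast
      then show ?thesis using len[OF u w] by (cases b; cases c) (auto simp: normal_form_def)
    qed
    then show ?thesis using rep[OF u] by blast
  qed
  show "word_class n \<tau> [Blue i, Red] = {[Blue i, Red], [Red, Blue (\<tau> i)]}" if i: "i \<in> {1..n}"
  proof -
    have u: "[Blue i, Red] \<in> words n" "[Red, Blue (\<tau> i)] \<in> words n"
      using i perm_in[OF perm i] by simp_all
    have "w = [Blue i, Red] \<or> w = [Red, Blue (\<tau> i)]" if w: "w \<in> word_class n \<tau> [Blue i, Red]" for w
    proof -
      obtain b c where "w = [b, c]" using len[OF u(1) w] two by blast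
      then show ?thesis using len[OF u(1) w] injD[OF permutes_inj[OF perm]]
        by (cases b; cases c) (auto simp: normal_form_def)
    qed
    moreover have "[Red, Blue (\<tau> i)] \<in> word_class n \<tau> [Blue i, Red]"
      using u by (simp add: word_class_conv normal_form_def)
    ultimately show ?thesis using rep[OF u(1)] by blast
  qed
qed

lemma relation_in_two_graph:
  "i \<in> {1..n} \<Longrightarrow> word_class n \<tau> [Blue i, Red] = word_class n \<tau> [Red, Blue (\<tau> i)]"
  using perm_in[OF perm, of i] by (simp add: word_class_eq_iff normal_form_def)

lemma factorization_sum_letter:
  assumes a: "a \<in> insert Red (Blue ` {1..n})"
  shows "(\<Sum>a\<in>factorizations (two_graph n \<tau>) (word_class n \<tau> [a]). f (fst a) * g (snd a)) =
    (f (word_class n \<tau> []) * g (word_class n \<tau> [a]) + f (word_class n \<tau> [a]) * g (word_class n \<tau> [])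
      :: 'c::semiring_0)"
proof -
  have u: "[a] \<in> words n" using a by simp
  have "factorizations (two_graph n \<tau>) (word_class n \<tau> [a]) =
      (\<Union>w\<in>{[a]}. (\<lambda>i. (word_class n \<tau> (take i w), word_class n \<tau> (drop i w))) ` {..length w})"
    unfolding factorizations_word_class[OF u] unfolding word_class_short(2)[OF a] ..
  also have "\<dots> = {(word_class n \<tau> [], word_class n \<tau> [a]), (word_class n \<tau> [a], word_class n \<tau> [])}"
    by (auto simp: atMost_Suc)
  finally have F: "factorizations (two_graph n \<tau>) (word_class n \<tau> [a]) = \<dots>" .
  have "word_class n \<tau> [] \<noteq> word_class n \<tau> [a]"
    unfolding word_class_short(1) word_class_short(2)[OF a] by simp
  then show ?thesis unfolding F by simp
qed

lemma factorization_sum_blue_blue: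
  assumes i: "i \<in> {1..n}" and j: "j \<in> {1..n}"
  defines "u \<equiv> [Blue i, Blue j]"
  shows "(\<Sum>a\<in>factorizations (two_graph n \<tau>) (word_class n \<tau> u). f (fst a) * g (snd a)) =
    (f (word_class n \<tau> []) * g (word_class n \<tau> u) + f (word_class n \<tau> [Blue i]) * g (word_class n \<tau> [Blue j])
      + f (word_class n \<tau> u) * g (word_class n \<tau> []) :: 'c::semiring_0)"
proof -
  have u: "u \<in> words n" using i j by (simp add: u_def)
  have w: "[Blue i] \<in> words n" using i by simp
  have "factorizations (two_graph n \<tau>) (word_class n \<tau> u) =
      (\<Union>w\<in>{u}. (\<lambda>i. (word_class n \<tau> (take i w), word_class n \<tau> (drop i w))) ` {..length w})"
    unfolding factorizations_word_class[OF u] unfolding u_def word_class_short(3)[OF i j] ..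
  also have "\<dots> = {(word_class n \<tau> [], word_class n \<tau> u), (word_class n \<tau> [Blue i], word_class n \<tau> [Blue j]),
       (word_class n \<tau> u, word_class n \<tau> [])}"
    by (auto simp: atMost_Suc u_def)
  finally have F: "factorizations (two_graph n \<tau>) (word_class n \<tau> u) = \<dots>" .
  have "word_class n \<tau> [] \<noteq> word_class n \<tau> u" "word_class n \<tau> [] \<noteq> word_class n \<tau> [Blue i]"
    "word_class n \<tau> [Blue i] \<noteq> word_class n \<tau> u"
    using u w by (simp_all add: word_class_eq_iff) (simp_all add: normal_form_def u_def)
  then show ?thesis unfolding F by (simp add: add.assoc)
qed

lemma factorization_sum_blue_red:
  assumes i: "i \<in> {1..n}"
  defines "u \<equiv> [Blue i, Red]"
  shows "(\<Sum>a\<in>factorizations (two_graph n \<tau>) (word_class n \<tau> u). f (fst a) * g (snd a)) =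
    (f (word_class n \<tau> []) * g (word_class n \<tau> u) + f (word_class n \<tau> [Red]) * g (word_class n \<tau> [Blue (\<tau> i)])
      + f (word_class n \<tau> [Blue i]) * g (word_class n \<tau> [Red])
      + f (word_class n \<tau> u) * g (word_class n \<tau> []) :: 'c::semiring_0)"
proof -
  have u: "u \<in> words n" using i by (simp add: u_def)
  have w: "[Blue i] \<in> words n" "[Red] \<in> words n" using i by simp_all
  have "factorizations (two_graph n \<tau>) (word_class n \<tau> u) =
      (\<Union>w\<in>{u, [Red, Blue (\<tau> i)]}.
        (\<lambda>i. (word_class n \<tau> (take i w), word_class n \<tau> (drop i w))) ` {..length w})"
    unfolding factorizations_word_class[OF u] unfolding u_def word_class_short(4)[OF i] ..
  also have "\<dots> =
      {(word_class n \<tau> [], word_class n \<tau> u), (word_class n \<tau> [Red], word_class n \<tau> [Blue (\<tau> i)]),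
       (word_class n \<tau> [Blue i], word_class n \<tau> [Red]), (word_class n \<tau> u, word_class n \<tau> [])}"
    using relation_in_two_graph[OF i] by (auto simp: atMost_Suc u_def)
  finally have F: "factorizations (two_graph n \<tau>) (word_class n \<tau> u) = \<dots>" .
  have "word_class n \<tau> [] \<noteq> word_class n \<tau> u" "word_class n \<tau> [] \<noteq> word_class n \<tau> [Blue i]"
    "word_class n \<tau> [] \<noteq> word_class n \<tau> [Red]" "word_class n \<tau> [Red] \<noteq> word_class n \<tau> [Blue i]"
    "word_class n \<tau> [Blue i] \<noteq> word_class n \<tau> u" "word_class n \<tau> [Red] \<noteq> word_class n \<tau> u"
    using u w by (simp_all add: word_class_eq_iff) (simp_all add: normal_form_def u_def)
  then show ?thesis unfolding F by (simp add: add.assoc)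
qed

end

section \<open>Coefficients of an isomorphism in low degree\<close>

text \<open>Index \<open>0\<close> is the red edge, so that \<open>{..n}\<close> indexes all generators and a homomorphism has a square
  matrix of linear coefficients when the ranks agree.\<close>

definition generator :: "nat \<Rightarrow> (nat \<Rightarrow> nat) \<Rightarrow> nat \<Rightarrow> edge list set" where
  "generator n \<tau> j = word_class n \<tau> [if j = 0 then Red else Blue j]"

text \<open>This captures what an isomorphism \<open>\<phi>\<close> from an algebra of \<open>\<Lambda>\<^sub>2\<close> to one of \<open>\<Lambda>\<^sub>1\<close> is used for: \<open>g T u\<close> is
  the coefficient of \<open>\<phi>(T) \<xi>\<^sub>1\<close> at \<open>u\<close>. The last condition is continuity of the linear coefficients,
  phrased so that it has the same form for the norm and the weak operator topology.\<close>

locale coefficient_homomorphism =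
  fixes n1 n2 :: nat and \<tau>1 \<tau>2 :: "nat \<Rightarrow> nat"
    and X :: "edge list set ell2_op topology" and g :: "edge list set ell2_op \<Rightarrow> edge list set \<Rightarrow> complex"
    and B :: "edge list set ell2_op set"
  defines "B \<equiv> generated_algebra X (two_graph n2 \<tau>2)"
  assumes perm1: "\<tau>1 permutes {1..n1}" and perm2: "\<tau>2 permutes {1..n2}"
    and X: "coordinate_continuous X"
    and add: "\<lbrakk>S \<in> B; T \<in> B\<rbrakk> \<Longrightarrow> g (S + T) u = g S u + g T u"
    and scale: "T \<in> B \<Longrightarrow> g (cscale_op c T) u = c * g T u"
    and mult: "\<lbrakk>S \<in> B; T \<in> B\<rbrakk> \<Longrightarrow> g (S o\<^sub>L T) u =
      (\<Sum>a\<in>factorizations (two_graph n1 \<tau>1) u. g S (fst a) * g T (snd a))"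
    and onto: "v \<in> carrier (two_graph n1 \<tau>1) \<Longrightarrow> \<exists>T\<in>B. \<forall>u. g T u = (if u = v then 1 else 0)"
    and closed: "closedin X {T \<in> B. (\<Sum>j\<le>n1. l j * g T (generator n1 \<tau>1 j)) = 0}"
begin

interpretation M1: finitely_factorizable_monoid "two_graph n1 \<tau>1"
  by (rule finitely_factorizable_two_graph[OF perm1])

interpretation M2: finitely_factorizable_monoid "two_graph n2 \<tau>2"
  by (rule finitely_factorizable_two_graph[OF perm2])

abbreviation "cls1 \<equiv> word_class n1 \<tau>1"
abbreviation "cls2 \<equiv> word_class n2 \<tau>2"
abbreviation "L w \<equiv> creation (two_graph n2 \<tau>2) (cls2 w)"

lemma B_subalgebra: "op_subalgebra B"
  unfolding B_def by (rule generated_algebra_closed(1)[OF X])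

lemma B_comp: "\<lbrakk>S \<in> B; T \<in> B\<rbrakk> \<Longrightarrow> S o\<^sub>L T \<in> B"
  using B_subalgebra by (simp add: op_subalgebra_def)

lemma L_in_B: "w \<in> words n2 \<Longrightarrow> L w \<in> B"
  unfolding B_def by (intro creation_in_generated_algebra[OF X] word_class_carrier[OF perm2])

lemma L_append: "\<lbrakk>u \<in> words n2; v \<in> words n2\<rbrakk> \<Longrightarrow> L (u @ v) = L u o\<^sub>L L v"
  by (simp add: word_class_mult[OF perm2, symmetric] word_class_carrier[OF perm2] M2.creation_mult)

lemma letter1: "j \<le> n1 \<Longrightarrow> (if j = 0 then Red else Blue j) \<in> insert Red (Blue ` {1..n1})"
  by auto

text \<open>The unit of the algebra of \<open>\<Lambda>\<^sub>2\<close> is a left unit for a preimage of the unit of the other algebra, so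
  its image is that unit.\<close>

lemma coefficient_unit:
  assumes u: "u \<in> words n1"
  shows "g (L []) (cls1 u) = (if normal_form \<tau>1 u = (0, []) then 1 else 0)"
proof -
  let ?F = "factorizations (two_graph n1 \<tau>1) (cls1 u)"
  obtain T where T: "T \<in> B" "\<And>u. g T u = (if u = cls1 [] then 1 else 0)"
    using onto[OF word_class_carrier[OF perm1 words_Nil]] by blast
  have "L [] o\<^sub>L T = T"
    using M2.creation_one_compose[OF M2.generated_algebra_left_convolution[OF X]] T(1)
    by (simp add: B_def one_two_graph[OF perm2])
  then have "g T (cls1 u) = (\<Sum>a\<in>?F. g (L []) (fst a) * g T (snd a))"
    using mult[OF L_in_B[OF words_Nil] T(1), of "cls1 u"] by simp
  also have "\<dots> = (\<Sum>a\<in>{(cls1 u, cls1 [])}. g (L []) (fst a) * g T (snd a))"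
  proof (rule sum.mono_neutral_right)
    have r_one: "x \<otimes>\<^bsub>two_graph n1 \<tau>1\<^esub> cls1 [] = x" if "x \<in> carrier (two_graph n1 \<tau>1)" for x
      using M1.r_one[OF that] by (simp only: one_two_graph[OF perm1])
    show "finite ?F" by (rule M1.finite_factorizations)
    show "{(cls1 u, cls1 [])} \<subseteq> ?F"
      using word_class_carrier[OF perm1] u r_one by (simp add: factorizations_def)
    show "\<forall>a\<in>?F - {(cls1 u, cls1 [])}. g (L []) (fst a) * g T (snd a) = 0"
      using r_one by (auto simp: factorizations_def T(2))
  qed
  also have "\<dots> = g (L []) (cls1 u)" by (simp add: T(2))
  finally have "g (L []) (cls1 u) = (if cls1 u = cls1 [] then 1 else 0)" by (simp only: T(2))
  moreover have "cls1 u = cls1 [] \<longleftrightarrow> normal_form \<tau>1 u = (0, [])"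
    unfolding word_class_eq_iff[OF perm1 u words_Nil] by (simp add: normal_form_def)
  ultimately show ?thesis by simp
qed

lemma coefficient_zero: "g 0 u = 0"
proof -
  have "0 \<in> B" using B_subalgebra by (simp add: op_subalgebra_def)
  from add[OF this this] show ?thesis by simp
qed

lemma mult_generator:
  "\<lbrakk>S \<in> B; T \<in> B; j \<le> n1\<rbrakk> \<Longrightarrow> g (S o\<^sub>L T) (generator n1 \<tau>1 j) =
    g S (cls1 []) * g T (generator n1 \<tau>1 j) + g S (generator n1 \<tau>1 j) * g T (cls1 [])"
  unfolding generator_def by (simp add: mult factorization_sum_letter[OF perm1 letter1] del: insert_iff)

text \<open>A functional \<open>l\<close> on linear coefficients induces the map \<open>D\<close> below, a point derivation at the character
  \<open>T \<mapsto> g T 1\<close>. Its zero set is a closed subalgebra. If \<open>D\<close> vanishes on the generators it vanishes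
  throughout, in particular on operators whose image is a single generator, where it takes the values
  of \<open>l\<close>.\<close>

lemma generator_coefficients_trivial_kernel:
  assumes ker: "\<And>i. i \<le> n2 \<Longrightarrow>
    (\<Sum>j\<le>n1. g (creation (two_graph n2 \<tau>2) (generator n2 \<tau>2 i)) (generator n1 \<tau>1 j) * l j) = 0"
  shows "\<forall>j\<le>n1. l j = 0"
proof -
  define D where "D T = (\<Sum>j\<le>n1. l j * g T (generator n1 \<tau>1 j))" for T
  have D_comp: "D (S o\<^sub>L T) = g S (cls1 []) * D T + D S * g T (cls1 [])" if "S \<in> B" "T \<in> B" for S T
    using that by (simp add: D_def mult_generator distrib_left sum.distrib sum_distrib_left sum_distrib_right mult_ac)
  define W where "W = {T \<in> B. D T = 0}"
  have "op_subalgebra W"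
    unfolding op_subalgebra_def
  proof (intro conjI ballI allI)
    show "0 \<in> W" using B_subalgebra by (simp add: W_def D_def op_subalgebra_def coefficient_zero)
    show "S + T \<in> W" "S o\<^sub>L T \<in> W" if "S \<in> W" "T \<in> W" for S T
    proof -
      have ST: "S \<in> B" "T \<in> B" "D S = 0" "D T = 0" using that by (auto simp: W_def)
      have "D (S + T) = D S + D T" using ST by (simp add: D_def add distrib_left sum.distrib)
      then show "S + T \<in> W" using B_subalgebra ST by (simp add: W_def op_subalgebra_def)
      show "S o\<^sub>L T \<in> W" using D_comp[OF ST(1,2)] ST B_comp by (simp add: W_def)
    qed
    show "cscale_op c T \<in> W" if "T \<in> W" for c T
    proof -
      have T: "T \<in> B" "D T = 0" using that by (auto simp: W_def)
      have "D (cscale_op c T) = c * D T" using T(1) by (simp add: D_def scale sum_distrib_left mult.left_commute)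
      then show ?thesis using B_subalgebra T by (simp add: W_def op_subalgebra_def)
    qed
  qed
  moreover have "closedin X W" unfolding W_def D_def by (rule closed)
  moreover have "creation (two_graph n2 \<tau>2) v \<in> W" if v: "v \<in> carrier (two_graph n2 \<tau>2)" for v
  proof -
    have letter: "L [a] \<in> W" if a: "a \<in> insert Red (Blue ` {1..n2})" for a
    proof -
      obtain i where i: "i \<le> n2" "a = (if i = 0 then Red else Blue i)"
        using a by (cases a) (auto intro: that[of 0])
      have "D (L [a]) = 0" using ker[OF i(1)] i(2) by (simp add: D_def generator_def mult.commute)
      then show ?thesis using L_in_B a by (simp add: W_def)
    qed
    have "L w \<in> W" if "w \<in> words n2" for w
      using that
    proof (induction w)
      case Nil
      have "g (L []) (generator n1 \<tau>1 j) = 0" if "j \<le> n1" for j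
        using coefficient_unit[of "[if j = 0 then Red else Blue j]"] letter1[OF that]
        by (auto simp: generator_def normal_form_def)
      then show ?case using L_in_B by (simp add: W_def D_def)
    next
      case (Cons a w)
      then have "L [a] \<in> W" "L w \<in> W" using letter by simp_all
      then have "L [a] o\<^sub>L L w \<in> W" using \<open>op_subalgebra W\<close> by (simp add: op_subalgebra_def)
      moreover have "L (a # w) = L [a] o\<^sub>L L w" using L_append[of "[a]" w] Cons.prems by simp
      ultimately show ?case by simp
    qed
    then show ?thesis using word_classE[OF perm2 v] by metis
  qed
  ultimately have "B \<subseteq> W" unfolding B_def by (rule generated_algebra_minimal[OF X])
  show ?thesis
  proof (intro allI impI)
    fix j assume j: "j \<le> n1"
    have inj: "generator n1 \<tau>1 i = generator n1 \<tau>1 j \<longleftrightarrow> i = j" if "i \<le> n1" for i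
      using letter1[OF that] letter1[OF j]
      by (simp add: generator_def word_class_eq_iff[OF perm1] del: insert_iff) (auto simp: normal_form_def)
    have "generator n1 \<tau>1 j \<in> carrier (two_graph n1 \<tau>1)"
      unfolding generator_def using letter1[OF j] by (intro word_class_carrier[OF perm1]) simp
    from onto[OF this] obtain T where T: "T \<in> B"
      "\<And>u. g T u = (if u = generator n1 \<tau>1 j then 1 else 0)" by blast
    have "D T = (\<Sum>i\<le>n1. if i = j then l i else 0)"
      unfolding D_def by (intro sum.cong HOL.refl) (use inj in \<open>simp add: T(2)\<close>)
    also have "\<dots> = l j" using j by simp
    finally show "l j = 0" using T(1) \<open>B \<subseteq> W\<close> by (auto simp: W_def)
  qed
qed

lemma rank_le: "n1 \<le> n2"
proof (rule trivial_kernel_imp_le)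
  let ?Y = "\<lambda>i j. g (creation (two_graph n2 \<tau>2) (generator n2 \<tau>2 i)) (generator n1 \<tau>1 j)"
  fix l assume ker: "\<And>i. i \<le> n2 \<Longrightarrow> (\<Sum>j\<le>n1. ?Y i j * l j) = 0"
  show "\<forall>j\<le>n1. l j = 0" by (rule generator_coefficients_trivial_kernel) (rule ker)
qed

text \<open>The relation \<open>e\<^sub>i f = f e\<^bsub>\<tau>2(i)\<^esub>\<close> is compared in degrees one and two. The constant terms \<open>\<alpha>\<close> record which
  character of the algebra of \<open>\<Lambda>\<^sub>2\<close> corresponds to the vacuum character. Degree one constrains them
  enough to eliminate them, and the unknown coefficients at words of length two, from degree two.\<close>

lemma conjugate:
  assumes eq: "n1 = n" "n2 = n" and n: "2 \<le> n"
  obtains \<sigma> where "bij_betw \<sigma> {1..n} {1..n}" "\<And>i. i \<in> {1..n} \<Longrightarrow> \<sigma> (\<tau>1 i) = \<tau>2 (\<sigma> i)"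
proof -
  define Y where "Y i j = g (creation (two_graph n2 \<tau>2) (generator n2 \<tau>2 i)) (generator n1 \<tau>1 j)" for i j
  define \<alpha> where "\<alpha> i = g (creation (two_graph n2 \<tau>2) (generator n2 \<tau>2 i)) (cls1 [])" for i
  have ker: "\<forall>j\<le>n. l j = 0" if "\<And>i. i \<le> n \<Longrightarrow> (\<Sum>j\<le>n. Y i j * l j) = 0" for l
  proof -
    have "\<forall>j\<le>n1. l j = 0"
    proof (rule generator_coefficients_trivial_kernel)
      fix i assume "i \<le> n2"
      then show "(\<Sum>j\<le>n1. g (creation (two_graph n2 \<tau>2) (generator n2 \<tau>2 i)) (generator n1 \<tau>1 j) * l j) = 0"
        using that[of i] by (simp only: Y_def eq)
    qed
    then show ?thesis unfolding eq .
  qed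
  obtain Z where YZ: "\<And>i k. i \<le> n \<Longrightarrow> k \<le> n \<Longrightarrow> (\<Sum>j\<le>n. Y i j * Z j k) = (if i = k then 1 else 0)"
    and "\<And>i k. i \<le> n \<Longrightarrow> k \<le> n \<Longrightarrow> (\<Sum>j\<le>n. Z i j * Y j k) = (if i = k then 1 else 0)"
    using trivial_kernel_imp_inverse[OF ker] by blast
  have tau_in: "\<tau>1 i \<in> {1..n}" "\<tau>2 i \<in> {1..n}" if "i \<in> {1..n}" for i
    using perm_in[OF perm1, of i] perm_in[OF perm2, of i] that unfolding eq by blast+
  have blue: "generator n1 \<tau>1 j = cls1 [Blue j]" "generator n2 \<tau>2 j = cls2 [Blue j]" if "j \<in> {1..n}" for j
    using that by (simp_all add: generator_def)
  have red: "generator n1 \<tau>1 0 = cls1 [Red]" "generator n2 \<tau>2 0 = cls2 [Red]"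
    by (simp_all add: generator_def)
  define E where "E i = creation (two_graph n2 \<tau>2) (generator n2 \<tau>2 i)" for i
  have rel: "E i o\<^sub>L E 0 = E 0 o\<^sub>L E (\<tau>2 i)" if i: "i \<in> {1..n}" for i
  proof -
    have w: "[Blue i] \<in> words n2" "[Red] \<in> words n2" "[Blue (\<tau>2 i)] \<in> words n2"
      using i tau_in(2)[OF i] unfolding eq by simp_all
    have "L ([Blue i] @ [Red]) = L ([Red] @ [Blue (\<tau>2 i)])"
      using relation_in_two_graph[OF perm2, of i] i unfolding eq by simp
    then show ?thesis
      unfolding L_append[OF w(1,2)] L_append[OF w(2,3)] E_def red blue(2)[OF i] blue(2)[OF tau_in(2)[OF i]] .
  qed
  have E_in: "E i \<in> B" if "i \<le> n" for i
    unfolding E_def generator_def using that eq by (intro L_in_B) auto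
  have E_in': "E i \<in> B" "E (\<tau>2 i) \<in> B" "E 0 \<in> B" if "i \<in> {1..n}" for i
    using E_in that tau_in(2)[OF that] by simp_all
  have \<alpha>: "g (E i) (cls1 []) = \<alpha> i" and Y: "g (E i) (generator n1 \<tau>1 j) = Y i j" for i j
    by (simp_all add: E_def \<alpha>_def Y_def)
  \<comment> \<open>Degree one of the relation.\<close>
  have lin: "(\<alpha> i - \<alpha> (\<tau>2 i)) * Y 0 j + \<alpha> 0 * (Y i j - Y (\<tau>2 i) j) = 0" if i: "i \<in> {1..n}" and j: "j \<le> n" for i j
  proof -
    have j': "j \<le> n1" using j eq by simp
    have "\<alpha> i * Y 0 j + Y i j * \<alpha> 0 = \<alpha> 0 * Y (\<tau>2 i) j + Y 0 j * \<alpha> (\<tau>2 i)"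
      using mult_generator[OF E_in'(1,3)[OF i] j'] mult_generator[OF E_in'(3,2)[OF i] j'] rel[OF i]
      by (simp add: \<alpha> Y)
    then show ?thesis by (simp add: algebra_simps)
  qed
  \<comment> \<open>The rows of \<open>Y\<close> are independent; multiplying by the inverse matrix extracts their coefficients.\<close>
  have lin': "(\<alpha> i - \<alpha> (\<tau>2 i)) * (if 0 = k then 1 else 0) +
      \<alpha> 0 * ((if i = k then 1 else 0) - (if \<tau>2 i = k then 1 else 0)) = 0"
    if i: "i \<in> {1..n}" and k: "k \<le> n" for i k
  proof -
    have "0 = (\<Sum>j\<le>n. ((\<alpha> i - \<alpha> (\<tau>2 i)) * Y 0 j + \<alpha> 0 * (Y i j - Y (\<tau>2 i) j)) * Z j k)"
      using lin[OF i] by (intro sum.neutral[symmetric]) simp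
    also have "\<dots> = (\<alpha> i - \<alpha> (\<tau>2 i)) * (\<Sum>j\<le>n. Y 0 j * Z j k) +
        \<alpha> 0 * ((\<Sum>j\<le>n. Y i j * Z j k) - (\<Sum>j\<le>n. Y (\<tau>2 i) j * Z j k))"
      by (simp add: algebra_simps sum.distrib sum_subtractf sum_distrib_left)
    also have "\<dots> = (\<alpha> i - \<alpha> (\<tau>2 i)) * (if 0 = k then 1 else 0) +
      \<alpha> 0 * ((if i = k then 1 else 0) - (if \<tau>2 i = k then 1 else 0))"
      using i k tau_in(2)[OF i] by (simp only: YZ[OF le0 k] YZ[OF _ k] atLeastAtMost_iff)
    finally show ?thesis by simp
  qed
  have \<alpha>_eq: "\<alpha> (\<tau>2 i) = \<alpha> i" if i: "i \<in> {1..n}" for i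
    using lin'[OF i, of 0] i tau_in(2)[OF i] by simp
  have \<alpha>0: "\<alpha> 0 = 0 \<or> \<tau>2 i = i" if i: "i \<in> {1..n}" for i
    using lin'[OF i, of i] i by (auto split: if_splits)
  \<comment> \<open>These are the parts of the degree two equations that involve a constant term.\<close>
  have quad: "\<alpha> i * g (E 0) u + g (E i) u * \<alpha> 0 = \<alpha> 0 * g (E (\<tau>2 i)) u + g (E 0) u * \<alpha> (\<tau>2 i)"
    if i: "i \<in> {1..n}" for i u
    using \<alpha>_eq[OF i] \<alpha>0[OF i] by auto
  show ?thesis
  proof (rule quadratic_relations_imp_conjugate[of \<tau>1 n \<tau>2 Y])
    fix i j k assume i: "i \<in> {1..n}" and j: "j \<in> {1..n}" and k: "k \<in> {1..n}"
    have jk: "j \<in> {1..n1}" "k \<in> {1..n1}" using j k eq by simp_all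
    let ?u = "cls1 [Blue j, Blue k]"
    have "\<alpha> i * g (E 0) ?u + Y i j * Y 0 k + g (E i) ?u * \<alpha> 0 =
        \<alpha> 0 * g (E (\<tau>2 i)) ?u + Y 0 j * Y (\<tau>2 i) k + g (E 0) ?u * \<alpha> (\<tau>2 i)"
      using mult[OF E_in'(1,3)[OF i], of ?u] mult[OF E_in'(3,2)[OF i], of ?u] rel[OF i]
      by (simp only: factorization_sum_blue_blue[OF perm1 jk] \<alpha> blue[OF j, symmetric] blue[OF k, symmetric] Y)
    then show "Y i j * Y 0 k = Y 0 j * Y (\<tau>2 i) k" using quad[OF i, of ?u] by (simp add: algebra_simps)
  next
    fix i j assume i: "i \<in> {1..n}" and j: "j \<in> {1..n}"
    have j': "j \<in> {1..n1}" using j eq by simp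
    let ?u = "cls1 [Blue j, Red]"
    have "\<alpha> i * g (E 0) ?u + Y i 0 * Y 0 (\<tau>1 j) + Y i j * Y 0 0 + g (E i) ?u * \<alpha> 0 =
        \<alpha> 0 * g (E (\<tau>2 i)) ?u + Y 0 0 * Y (\<tau>2 i) (\<tau>1 j) + Y 0 j * Y (\<tau>2 i) 0 + g (E 0) ?u * \<alpha> (\<tau>2 i)"
      using mult[OF E_in'(1,3)[OF i], of ?u] mult[OF E_in'(3,2)[OF i], of ?u] rel[OF i]
      by (simp only: factorization_sum_blue_red[OF perm1 j'] \<alpha> red(1)[symmetric]
          blue[OF j, symmetric] blue[OF tau_in(1)[OF j], symmetric] Y)
    then show "Y i 0 * Y 0 (\<tau>1 j) + Y i j * Y 0 0 = Y 0 0 * Y (\<tau>2 i) (\<tau>1 j) + Y 0 j * Y (\<tau>2 i) 0"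
      using quad[OF i, of ?u] by (simp add: algebra_simps)
  qed (use perm1 perm2 eq n ker that in auto)
qed

end

section \<open>Equivalent algebras have coefficient homomorphisms\<close>

lemma isometrically_isomorphic_sym:
  assumes "isometrically_isomorphic A B" "op_subalgebra A" shows "isometrically_isomorphic B A"
proof -
  obtain \<phi> where bij: "bij_betw \<phi> A B"
    and hom: "\<And>S T. S \<in> A \<Longrightarrow> T \<in> A \<Longrightarrow> \<phi> (S + T) = \<phi> S + \<phi> T \<and> \<phi> (S o\<^sub>L T) = \<phi> S o\<^sub>L \<phi> T"
    and scale: "\<And>c T. T \<in> A \<Longrightarrow> \<phi> (cscale_op c T) = cscale_op c (\<phi> T)"
    and norm: "\<And>T. T \<in> A \<Longrightarrow> norm (\<phi> T) = norm T"
    using assms(1) unfolding isometrically_isomorphic_def by blast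
  let ?\<psi> = "inv_into A \<phi>"
  have \<psi>: "?\<psi> T \<in> A" "\<phi> (?\<psi> T) = T" if "T \<in> B" for T
    using that bij_betwE[OF bij_betw_inv_into[OF bij]] bij_betw_inv_into_right[OF bij] by blast+
  have eq: "?\<psi> T = S" if "S \<in> A" "\<phi> S = T" for S T
    using that bij_betw_inv_into_left[OF bij] by blast
  have closed: "S + T \<in> A" "S o\<^sub>L T \<in> A" if "S \<in> A" "T \<in> A" for S T
    using assms(2) that by (auto simp: op_subalgebra_def)
  have closed': "cscale_op c T \<in> A" if "T \<in> A" for T c
    using assms(2) that by (auto simp: op_subalgebra_def)
  show ?thesis
    unfolding isometrically_isomorphic_def
  proof (intro exI[of _ ?\<psi>] conjI ballI allI)
    show "bij_betw ?\<psi> B A" by (rule bij_betw_inv_into[OF bij])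
    show "?\<psi> (S + T) = ?\<psi> S + ?\<psi> T" if "S \<in> B" "T \<in> B" for S T
      by (rule eq) (use that \<psi> closed hom in simp_all)
    show "?\<psi> (S o\<^sub>L T) = ?\<psi> S o\<^sub>L ?\<psi> T" if "S \<in> B" "T \<in> B" for S T
      by (rule eq) (use that \<psi> closed hom in simp_all)
    show "?\<psi> (cscale_op c T) = cscale_op c (?\<psi> T)" if "T \<in> B" for c T
      by (rule eq) (use that \<psi> closed' scale in simp_all)
    show "norm (?\<psi> T) = norm T" if "T \<in> B" for T
      using norm[OF \<psi>(1)[OF that]] \<psi>(2)[OF that] by simp
  qed
qed

lemma fock_add: "x \<in> fock M \<Longrightarrow> y \<in> fock M \<Longrightarrow> x + y \<in> fock M"
  by (simp add: fock_def coord_add)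

lemma fock_cscale: "x \<in> fock M \<Longrightarrow> cscale c x \<in> fock M"
  by (simp add: fock_def coord_cscale)

lemma ket_fock: "v \<in> carrier M \<Longrightarrow> ket v \<in> fock M"
  by (auto simp: fock_def coord_ket)

lemma L_alg_unitarily_equivalent_sym:
  fixes M :: "('a, 'm) monoid_scheme" and N :: "('b, 'k) monoid_scheme"
  assumes "L_alg_unitarily_equivalent M N"
    and LM: "\<And>S x. S \<in> L_alg M \<Longrightarrow> S x \<in> fock M"
  shows "L_alg_unitarily_equivalent N M"
proof -
  obtain U where U: "fock_unitary M N U"
    and ST: "\<And>S. S \<in> L_alg M \<Longrightarrow> \<exists>T\<in>L_alg N. \<forall>x\<in>fock M. T (U x) = U (S x)"
    and TS: "\<And>T. T \<in> L_alg N \<Longrightarrow> \<exists>S\<in>L_alg M. \<forall>x\<in>fock M. T (U x) = U (S x)"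
    using assms(1) unfolding L_alg_unitarily_equivalent_def by blast
  have bij: "bij_betw U (fock M) (fock N)"
    and add: "\<And>x y. x \<in> fock M \<Longrightarrow> y \<in> fock M \<Longrightarrow> U (x + y) = U x + U y"
    and inner: "\<And>x y. x \<in> fock M \<Longrightarrow> y \<in> fock M \<Longrightarrow> cinner (U x) (U y) = cinner x y"
    and scale: "\<And>c x. x \<in> fock M \<Longrightarrow> U (cscale c x) = cscale c (U x)"
    using U by (auto simp: fock_unitary_def)
  let ?V = "inv_into (fock M) U"
  have V: "?V y \<in> fock M" "U (?V y) = y" if "y \<in> fock N" for y
    using that bij_betwE[OF bij_betw_inv_into[OF bij]] bij_betw_inv_into_right[OF bij] by blast+
  have eq: "?V y = x" if "x \<in> fock M" "U x = y" for x y
    using that bij_betw_inv_into_left[OF bij] by blast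
  have intertwine: "S (?V y) = ?V (T y)"
    if "S \<in> L_alg M" "\<forall>x\<in>fock M. T (U x) = U (S x)" "y \<in> fock N" for S y and T :: "'b ell2_op"
  proof -
    have "U (S (?V y)) = T y" using that V[OF that(3)] by metis
    then show ?thesis using eq[OF LM[OF that(1)]] by metis
  qed
  have "fock_unitary N M ?V"
    unfolding fock_unitary_def
  proof (intro conjI ballI allI)
    show "bij_betw ?V (fock N) (fock M)" by (rule bij_betw_inv_into[OF bij])
    show "?V (x + y) = ?V x + ?V y" if "x \<in> fock N" "y \<in> fock N" for x y
      by (rule eq) (use that in \<open>simp_all add: V fock_add add\<close>)
    show "cinner (?V x) (?V y) = cinner x y" if "x \<in> fock N" "y \<in> fock N" for x y
      using inner[OF V(1)[OF that(1)] V(1)[OF that(2)]] V(2)[OF that(1)] V(2)[OF that(2)] by simp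
    show "?V (cscale c x) = cscale c (?V x)" if "x \<in> fock N" for c x
      by (rule eq) (use that in \<open>simp_all add: V fock_cscale scale\<close>)
  qed
  moreover have "\<exists>S\<in>L_alg M. \<forall>y\<in>fock N. S (?V y) = ?V (T y)" if T: "T \<in> L_alg N" for T
  proof -
    obtain S where "S \<in> L_alg M" "\<forall>x\<in>fock M. T (U x) = U (S x)" using TS[OF T] by blast
    then show ?thesis using intertwine by blast
  qed
  moreover have "\<exists>T\<in>L_alg N. \<forall>y\<in>fock N. S (?V y) = ?V (T y)" if S: "S \<in> L_alg M" for S
  proof -
    obtain T where "T \<in> L_alg N" "\<forall>x\<in>fock M. T (U x) = U (S x)" using ST[OF S] by blast
    then show ?thesis using intertwine[OF S] by blast
  qed
  ultimately show ?thesis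
    unfolding L_alg_unitarily_equivalent_def by (intro exI[of _ ?V]) simp
qed

text \<open>A map \<open>\<phi>\<close> into left convolution operators is multiplicative on coefficients as soon as it is
  multiplicative on the vacuum vector. Asking for the homomorphism laws on this vector only allows \<open>\<phi>\<close> to
  be given by an arbitrary choice of operators intertwined by a unitary.\<close>

lemma coefficient_homomorphism_of_representation:
  fixes \<phi> :: "edge list set ell2_op \<Rightarrow> edge list set ell2_op"
  defines "k \<equiv> \<lambda>n \<tau>. ket \<one>\<^bsub>two_graph n \<tau>\<^esub>"
  assumes p1: "\<tau>1 permutes {1..n1}" and p2: "\<tau>2 permutes {1..n2}"
    and X: "coordinate_continuous X" and B: "B = generated_algebra X (two_graph n2 \<tau>2)"
    and conv: "\<And>T. T \<in> B \<Longrightarrow> left_convolution (two_graph n1 \<tau>1) (\<phi> T)"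
    and add: "\<And>S T. S \<in> B \<Longrightarrow> T \<in> B \<Longrightarrow> \<phi> (S + T) (k n1 \<tau>1) = \<phi> S (k n1 \<tau>1) + \<phi> T (k n1 \<tau>1)"
    and comp: "\<And>S T. S \<in> B \<Longrightarrow> T \<in> B \<Longrightarrow> \<phi> (S o\<^sub>L T) (k n1 \<tau>1) = \<phi> S (\<phi> T (k n1 \<tau>1))"
    and scale: "\<And>c T. T \<in> B \<Longrightarrow> \<phi> (cscale_op c T) (k n1 \<tau>1) = cscale c (\<phi> T (k n1 \<tau>1))"
    and onto: "\<And>v. v \<in> carrier (two_graph n1 \<tau>1) \<Longrightarrow> \<exists>T\<in>B. \<phi> T (k n1 \<tau>1) = ket v"
    and closed: "\<And>l. closedin X {T \<in> B. (\<Sum>j\<le>n1. l j * coord (\<phi> T (k n1 \<tau>1)) (generator n1 \<tau>1 j)) = 0}"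
  shows "coefficient_homomorphism n1 n2 \<tau>1 \<tau>2 X (\<lambda>T. coord (\<phi> T (k n1 \<tau>1)))"
proof (rule coefficient_homomorphism.intro[OF p1 p2 X], unfold B[symmetric])
  show "coord (\<phi> (S + T) (k n1 \<tau>1)) u = coord (\<phi> S (k n1 \<tau>1)) u + coord (\<phi> T (k n1 \<tau>1)) u"
    if "S \<in> B" "T \<in> B" for S T u using that by (simp add: add coord_add)
  show "coord (\<phi> (cscale_op c T) (k n1 \<tau>1)) u = c * coord (\<phi> T (k n1 \<tau>1)) u"
    if "T \<in> B" for c T u using that by (simp add: scale coord_cscale)
  show "coord (\<phi> (S o\<^sub>L T) (k n1 \<tau>1)) u = (\<Sum>a\<in>factorizations (two_graph n1 \<tau>1) u.
      coord (\<phi> S (k n1 \<tau>1)) (fst a) * coord (\<phi> T (k n1 \<tau>1)) (snd a))"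
    if "S \<in> B" "T \<in> B" for S T u
    unfolding comp[OF that] unfolding k_def by (rule left_convolutionD[OF conv[OF that(1)]])
  show "\<exists>T\<in>B. \<forall>u. coord (\<phi> T (k n1 \<tau>1)) u = (if u = v then 1 else 0)"
    if "v \<in> carrier (two_graph n1 \<tau>1)" for v
    using onto[OF that] coord_ket[of v] by metis
  show "closedin X {T \<in> B. (\<Sum>j\<le>n1. l j * coord (\<phi> T (k n1 \<tau>1)) (generator n1 \<tau>1 j)) = 0}" for l
    by (rule closed)
qed

lemma A_algs_coefficient_homomorphism:
  assumes p1: "\<tau>1 permutes {1..n1}" and p2: "\<tau>2 permutes {1..n2}"
    and iso: "isometrically_isomorphic (A_alg (two_graph n2 \<tau>2)) (A_alg (two_graph n1 \<tau>1))"
  shows "\<exists>g. coefficient_homomorphism n1 n2 \<tau>1 \<tau>2 euclidean g"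
proof -
  let ?M = "two_graph n1 \<tau>1" and ?N = "two_graph n2 \<tau>2"
  define A where "A = generated_algebra euclidean ?M"
  define B where "B = generated_algebra euclidean ?N"
  note E = coordinate_continuous_euclidean
  interpret M: finitely_factorizable_monoid ?M by (rule finitely_factorizable_two_graph[OF p1])
  obtain \<phi> where bij: "bij_betw \<phi> B A"
    and hom: "\<And>S T. S \<in> B \<Longrightarrow> T \<in> B \<Longrightarrow> \<phi> (S + T) = \<phi> S + \<phi> T \<and> \<phi> (S o\<^sub>L T) = \<phi> S o\<^sub>L \<phi> T"
    and scale: "\<And>c T. T \<in> B \<Longrightarrow> \<phi> (cscale_op c T) = cscale_op c (\<phi> T)"
    and norm: "\<And>T. T \<in> B \<Longrightarrow> norm (\<phi> T) = norm T"
    using iso unfolding isometrically_isomorphic_def A_alg_eq A_def[symmetric] B_def[symmetric] by blast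
  have subalgebra: "op_subalgebra B" "closed B"
    using generated_algebra_closed[OF E, of ?N] by (simp_all add: B_def)
  have neg: "cscale_op (-1) T = - T" for T :: "edge list set ell2_op"
    by (rule blinfun_eqI, rule ell2_eqI)
      (simp add: cscale_op_apply coord_cscale blinfun.minus_left uminus_ell2.rep_eq)
  have dist: "norm (\<phi> S - \<phi> T) = norm (S - T)" if S: "S \<in> B" and T: "T \<in> B" for S T
  proof -
    have mT: "- T \<in> B" using subalgebra(1) T unfolding neg[symmetric] op_subalgebra_def by blast
    have "\<phi> (S + - T) = \<phi> S + \<phi> (- T)" using hom[OF S mT] by blast
    also have "\<phi> (- T) = - \<phi> T" using scale[OF T, of "-1"] by (simp only: neg)
    finally have "\<phi> (S - T) = \<phi> S - \<phi> T" by simp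
    moreover have "S + - T \<in> B" using subalgebra(1) S mT unfolding op_subalgebra_def by blast
    ultimately show ?thesis using norm[of "S - T"] by simp
  qed
  have "continuous_on B \<phi>"
    unfolding continuous_on_iff dist_norm using dist by metis
  then have cont: "continuous_on B (\<lambda>T. coord (\<phi> T x) u)" for x u
    by (intro bounded_linear.continuous_on[OF bounded_linear_coord]
        bounded_linear.continuous_on[OF blinfun.bounded_linear_left])
  have "coefficient_homomorphism n1 n2 \<tau>1 \<tau>2 euclidean (\<lambda>T. coord (\<phi> T (ket \<one>\<^bsub>?M\<^esub>)))"
  proof (rule coefficient_homomorphism_of_representation[OF p1 p2 E B_def])
    show "left_convolution ?M (\<phi> T)" if "T \<in> B" for T
      using bij_betwE[OF bij] that M.generated_algebra_left_convolution[OF E] unfolding A_def by blast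
    show "\<exists>T\<in>B. \<phi> T (ket \<one>\<^bsub>?M\<^esub>) = ket v" if v: "v \<in> carrier ?M" for v
    proof -
      have "creation ?M v \<in> \<phi> ` B"
        using bij_betw_imp_surj_on[OF bij] creation_in_generated_algebra[OF E v] unfolding A_def by blast
      moreover have "creation ?M v (ket \<one>\<^bsub>?M\<^esub>) = ket v"
        using creation_ket[OF M.left_cancel[OF v] M.one_closed] M.r_one[OF v] by simp
      ultimately show ?thesis by fastforce
    qed
    fix l :: "nat \<Rightarrow> complex"
    have "closedin (top_of_set B) (B \<inter> (\<lambda>T. \<Sum>j\<le>n1. l j * coord (\<phi> T (ket \<one>\<^bsub>?M\<^esub>)) (generator n1 \<tau>1 j)) -` {0})"
      by (intro continuous_closedin_preimage continuous_on_sum continuous_on_mult continuous_on_const cont) simp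
    then have "closed (B \<inter> (\<lambda>T. \<Sum>j\<le>n1. l j * coord (\<phi> T (ket \<one>\<^bsub>?M\<^esub>)) (generator n1 \<tau>1 j)) -` {0})"
      using subalgebra(2) by (rule closedin_closed_trans)
    then show "closedin euclidean {T \<in> B. (\<Sum>j\<le>n1. l j * coord (\<phi> T (ket \<one>\<^bsub>?M\<^esub>)) (generator n1 \<tau>1 j)) = 0}"
      by (simp add: vimage_def Int_def)
  qed (simp_all add: hom scale blinfun.add_left cscale_op_apply)
  then show ?thesis by blast
qed

text \<open>Conjugation with the unitary defines \<open>\<phi>\<close>. Its coefficients are matrix coefficients
  \<open>\<langle>T (U \<xi>\<^sub>1), U \<xi>\<^sub>u\<rangle>\<close> of \<open>T\<close>, hence continuous in the weak operator topology.\<close>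

lemma L_algs_coefficient_homomorphism:
  assumes p1: "\<tau>1 permutes {1..n1}" and p2: "\<tau>2 permutes {1..n2}"
    and equiv: "L_alg_unitarily_equivalent (two_graph n1 \<tau>1) (two_graph n2 \<tau>2)"
  shows "\<exists>g. coefficient_homomorphism n1 n2 \<tau>1 \<tau>2 weak_operator_topology g"
proof -
  let ?M = "two_graph n1 \<tau>1" and ?N = "two_graph n2 \<tau>2"
  define A where "A = generated_algebra weak_operator_topology ?M"
  define B where "B = generated_algebra weak_operator_topology ?N"
  note E = coordinate_continuous_weak_operator
  interpret M: finitely_factorizable_monoid ?M by (rule finitely_factorizable_two_graph[OF p1])
  obtain U where U: "fock_unitary ?M ?N U"
    and AB: "\<And>S. S \<in> A \<Longrightarrow> \<exists>T\<in>B. \<forall>x\<in>fock ?M. T (U x) = U (S x)"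
    and BA: "\<And>T. T \<in> B \<Longrightarrow> \<exists>S\<in>A. \<forall>x\<in>fock ?M. T (U x) = U (S x)"
    using equiv unfolding L_alg_unitarily_equivalent_def L_alg_eq A_def[symmetric] B_def[symmetric] by blast
  have bij: "bij_betw U (fock ?M) (fock ?N)"
    and add: "\<And>x y. x \<in> fock ?M \<Longrightarrow> y \<in> fock ?M \<Longrightarrow> U (x + y) = U x + U y"
    and inner: "\<And>x y. x \<in> fock ?M \<Longrightarrow> y \<in> fock ?M \<Longrightarrow> cinner (U x) (U y) = cinner x y"
    and scale: "\<And>c x. x \<in> fock ?M \<Longrightarrow> U (cscale c x) = cscale c (U x)"
    using U by (auto simp: fock_unitary_def)
  note inj = inj_onD[OF bij_betw_imp_inj_on[OF bij]]
  obtain \<phi> where \<phi>_in: "\<And>T. T \<in> B \<Longrightarrow> \<phi> T \<in> A"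
    and \<phi>: "\<And>T x. T \<in> B \<Longrightarrow> x \<in> fock ?M \<Longrightarrow> U (\<phi> T x) = T (U x)"
    using BA by metis
  have conv: "left_convolution ?M S" if "S \<in> A" for S
    using M.generated_algebra_left_convolution[OF E] that by (simp add: A_def)
  have fockA: "S x \<in> fock ?M" if "S \<in> A" for S x
    by (rule M.left_convolution_fock[OF conv[OF that]])
  define k where "k = ket \<one>\<^bsub>?M\<^esub>"
  have k: "k \<in> fock ?M" by (simp add: k_def ket_fock)
  have alg: "S + T \<in> B" "S o\<^sub>L T \<in> B" if "S \<in> B" "T \<in> B" for S T
    using generated_algebra_closed(1)[OF E] that unfolding B_def op_subalgebra_def by blast+
  have alg': "cscale_op c T \<in> B" if "T \<in> B" for c T
    using generated_algebra_closed(1)[OF E] that unfolding B_def op_subalgebra_def by blast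
  have "coefficient_homomorphism n1 n2 \<tau>1 \<tau>2 weak_operator_topology (\<lambda>T. coord (\<phi> T (ket \<one>\<^bsub>?M\<^esub>)))"
  proof (rule coefficient_homomorphism_of_representation[OF p1 p2 E B_def], unfold k_def[symmetric])
    show "left_convolution ?M (\<phi> T)" if "T \<in> B" for T by (rule conv[OF \<phi>_in[OF that]])
    show "\<phi> (S + T) k = \<phi> S k + \<phi> T k" if S: "S \<in> B" and T: "T \<in> B" for S T
    proof (rule inj)
      show "U (\<phi> (S + T) k) = U (\<phi> S k + \<phi> T k)"
        using S T k by (simp add: \<phi> alg add fockA \<phi>_in blinfun.add_left)
    qed (use S T in \<open>simp_all add: fockA fock_add \<phi>_in alg\<close>)
    show "\<phi> (S o\<^sub>L T) k = \<phi> S (\<phi> T k)" if S: "S \<in> B" and T: "T \<in> B" for S T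
    proof (rule inj)
      show "U (\<phi> (S o\<^sub>L T) k) = U (\<phi> S (\<phi> T k))"
        using S T k by (simp add: \<phi> alg fockA \<phi>_in)
    qed (use S T in \<open>simp_all add: fockA \<phi>_in alg\<close>)
    show "\<phi> (cscale_op c T) k = cscale c (\<phi> T k)" if T: "T \<in> B" for c T
    proof (rule inj)
      show "U (\<phi> (cscale_op c T) k) = U (cscale c (\<phi> T k))"
        using T k by (simp add: \<phi> alg' scale fockA \<phi>_in cscale_op_apply)
    qed (use T in \<open>simp_all add: fockA fock_cscale \<phi>_in alg'\<close>)
    show "\<exists>T\<in>B. \<phi> T k = ket v" if v: "v \<in> carrier ?M" for v
    proof -
      obtain T where T: "T \<in> B" "\<forall>x\<in>fock ?M. T (U x) = U (creation ?M v x)"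
        using AB[of "creation ?M v"] creation_in_generated_algebra[OF E v] unfolding A_def by blast
      have c: "creation ?M v k = ket v"
        using creation_ket[OF M.left_cancel[OF v] M.one_closed] M.r_one[OF v] by (simp add: k_def)
      have "\<phi> T k = ket v"
      proof (rule inj)
        show "U (\<phi> T k) = U (ket v)" using T k c by (simp add: \<phi>)
      qed (use T(1) v in \<open>simp_all add: fockA \<phi>_in ket_fock\<close>)
      then show ?thesis using T(1) by blast
    qed
    fix l :: "nat \<Rightarrow> complex"
    let ?u = "generator n1 \<tau>1"
    let ?D = "\<lambda>T. \<Sum>j\<le>n1. l j * cinner (blinfun_apply T (U k)) (U (ket (?u j)))"
    have u: "?u j \<in> carrier ?M" if "j \<le> n1" for j
      unfolding generator_def using that by (intro word_class_carrier[OF p1]) auto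
    have "coord (\<phi> T k) (?u j) = cinner (T (U k)) (U (ket (?u j)))" if "T \<in> B" "j \<le> n1" for T j
      using inner[OF fockA[OF \<phi>_in[OF that(1)]] ket_fock[OF u[OF that(2)]], of k] that(1) k
      by (simp add: \<phi> cinner_ket)
    then have "{T \<in> B. (\<Sum>j\<le>n1. l j * coord (\<phi> T k) (?u j)) = 0} = B \<inter> {T. ?D T = 0}"
      by auto
    moreover have "closedin weak_operator_topology {T. ?D T = 0}"
      by (rule closedin_zero_set)
        (intro continuous_map_sum continuous_map_complex_mult_left continuous_map_weak_operator_cinner
          finite_atMost topspace_weak_operator_topology)+
    then have "closedin weak_operator_topology (B \<inter> {T. ?D T = 0})"
      using generated_algebra_closed(2)[OF E] unfolding B_def by (intro closedin_Int)
    ultimately show "closedin weak_operator_topology {T \<in> B. (\<Sum>j\<le>n1. l j * coord (\<phi> T k) (?u j)) = 0}"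
      by simp
  qed
  then show ?thesis by blast
qed

section \<open>Composition operators between Fock spaces\<close>

definition compose_on :: "'b set \<Rightarrow> ('b \<Rightarrow> 'a) \<Rightarrow> ('a \<Rightarrow> complex) \<Rightarrow> 'b \<Rightarrow> complex" where
  "compose_on B k x u = (if u \<in> B then x (k u) else 0)"

definition composition_op :: "'b set \<Rightarrow> ('b \<Rightarrow> 'a) \<Rightarrow> 'a ell2 \<Rightarrow>\<^sub>L 'b ell2" where
  "composition_op B k = Blinfun (\<lambda>x. Abs_ell2 (compose_on B k (coord x)))"

context
  fixes B :: "'b set" and k :: "'b \<Rightarrow> 'a"
  assumes inj: "inj_on k B"
begin

private lemma restricted_has_sum:
  fixes x :: "'a ell2"
  shows "((\<lambda>u. (cmod (compose_on B k (coord x) u))\<^sup>2) has_sum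
    infsum (\<lambda>i. (cmod (coord x i))\<^sup>2) (k ` B)) UNIV"
proof -
  have "(\<lambda>i. (cmod (coord x i))\<^sup>2) summable_on k ` B"
    using coord[of x] by (auto simp: square_summable_def intro: summable_on_subset_banach)
  then have "((\<lambda>i. (cmod (coord x i))\<^sup>2) has_sum infsum (\<lambda>i. (cmod (coord x i))\<^sup>2) (k ` B)) (k ` B)"
    by simp
  then have "(((\<lambda>i. (cmod (coord x i))\<^sup>2) \<circ> k) has_sum infsum (\<lambda>i. (cmod (coord x i))\<^sup>2) (k ` B)) B"
    using has_sum_reindex[OF inj] by blast
  then show ?thesis
    by (rule has_sum_cong_neutral[THEN iffD1, rotated 3]) (auto simp: compose_on_def)
qed

private lemma coord_restricted:
  "coord (Abs_ell2 (compose_on B k (coord x))) = (compose_on B k (coord x))"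
proof -
  have "square_summable (compose_on B k (coord x))"
    unfolding square_summable_def using restricted_has_sum by (rule has_sum_imp_summable)
  then show ?thesis by (simp add: Abs_ell2_inverse)
qed

private lemma norm_restricted_le: "norm (Abs_ell2 (compose_on B k (coord x))) \<le> norm x"
proof (rule power2_le_imp_le)
  have s: "(\<lambda>i. (cmod (coord x i))\<^sup>2) summable_on UNIV"
    using coord[of x] by (simp add: square_summable_def)
  have "(norm (Abs_ell2 (compose_on B k (coord x))))\<^sup>2 =
      infsum (\<lambda>i. (cmod (coord x i))\<^sup>2) (k ` B)"
    unfolding norm_ell2_square coord_restricted using restricted_has_sum by (rule infsumI)
  also have "\<dots> \<le> (norm x)\<^sup>2"
    unfolding norm_ell2_square
    by (rule infsum_mono2) (use s in \<open>auto intro: summable_on_subset_banach\<close>)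
  finally show "(norm (Abs_ell2 (compose_on B k (coord x))))\<^sup>2 \<le> (norm x)\<^sup>2" .
qed simp

private lemma composition_op_apply:
  "composition_op B k x = Abs_ell2 (compose_on B k (coord x))"
proof -
  have "bounded_linear (\<lambda>x. Abs_ell2 (compose_on B k (coord x)))"
  proof (rule bounded_linear_intro)
    show "norm (Abs_ell2 (compose_on B k (coord x))) \<le> norm x * 1" for x
      by (simp only: norm_restricted_le mult_1_right)
  qed (simp_all only: coord_inject[symmetric] fun_eq_iff coord_add coord_scaleR coord_restricted, simp_all add: compose_on_def coord_add coord_scaleR)
  then show ?thesis unfolding composition_op_def by (simp only: bounded_linear_Blinfun_apply)
qed

lemma coord_composition_op: "coord (composition_op B k x) u = (if u \<in> B then coord x (k u) else 0)"
  unfolding composition_op_apply coord_restricted compose_on_def ..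

lemma norm_composition_op: "norm (composition_op B k) \<le> 1"
  by (rule norm_blinfun_bound) (simp_all add: composition_op_apply norm_restricted_le)

end

lemma cinner_composition_op:
  assumes bij: "bij_betw h A B" and k: "\<And>a. a \<in> A \<Longrightarrow> k (h a) = a"
  shows "cinner (composition_op B k x) y = cinner x (composition_op A h y)"
proof -
  have inj: "inj_on k B" "inj_on h A"
    using bij k by (auto simp: bij_betw_def intro!: inj_onI)
  have "cinner (composition_op B k x) y = infsum (\<lambda>u. coord x (k u) * cnj (coord y u)) B"
    unfolding cinner.rep_eq by (rule infsum_cong_neutral) (auto simp: coord_composition_op inj)
  also have "\<dots> = infsum (\<lambda>a. coord x (k (h a)) * cnj (coord y (h a))) A"
    using infsum_reindex_bij_betw[OF bij, of "\<lambda>u. coord x (k u) * cnj (coord y u)"] by simp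
  also have "\<dots> = cinner x (composition_op A h y)"
    unfolding cinner.rep_eq by (rule infsum_cong_neutral) (auto simp: coord_composition_op inj k)
  finally show ?thesis .
qed

section \<open>Isomorphic semigroups have equivalent algebras\<close>

text \<open>\<open>k\<close> is the inverse of the isomorphism \<open>h\<close> on the carriers. Having it as a parameter makes the situation
  symmetric, so that every result also holds with \<open>M\<close> and \<open>N\<close> exchanged.\<close>

locale fock_transport =
  M: finitely_factorizable_monoid M + N: finitely_factorizable_monoid N
  for M :: "('a, 'm) monoid_scheme" and N :: "('b, 'k) monoid_scheme" +
  fixes h :: "'a \<Rightarrow> 'b" and k :: "'b \<Rightarrow> 'a"
  assumes h_in: "a \<in> carrier M \<Longrightarrow> h a \<in> carrier N"
    and k_in: "b \<in> carrier N \<Longrightarrow> k b \<in> carrier M"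
    and k_h: "a \<in> carrier M \<Longrightarrow> k (h a) = a"
    and h_k: "b \<in> carrier N \<Longrightarrow> h (k b) = b"
    and h_mult: "\<lbrakk>a \<in> carrier M; a' \<in> carrier M\<rbrakk> \<Longrightarrow> h (a \<otimes>\<^bsub>M\<^esub> a') = h a \<otimes>\<^bsub>N\<^esub> h a'"
begin

text \<open>\<open>W\<close> is the unitary of the Fock spaces induced by \<open>h\<close>, extended by \<open>0\<close>, and \<open>W'\<close> is its adjoint.\<close>

definition W :: "'a ell2 \<Rightarrow>\<^sub>L 'b ell2" where "W = composition_op (carrier N) k"
definition W' :: "'b ell2 \<Rightarrow>\<^sub>L 'a ell2" where "W' = composition_op (carrier M) h"
definition conjugation :: "'a ell2_op \<Rightarrow> 'b ell2_op" where "conjugation T = W o\<^sub>L T o\<^sub>L W'"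

lemma inverse: "fock_transport N M k h"
proof
  fix b b' assume b: "b \<in> carrier N" "b' \<in> carrier N"
  have "b \<otimes>\<^bsub>N\<^esub> b' = h (k b \<otimes>\<^bsub>M\<^esub> k b')" using h_mult[OF k_in k_in, OF b] by (simp only: h_k b)
  then show "k (b \<otimes>\<^bsub>N\<^esub> b') = k b \<otimes>\<^bsub>M\<^esub> k b'" using k_h[of "k b \<otimes>\<^bsub>M\<^esub> k b'"] k_in b by simp
qed (fact h_in k_in k_h h_k)+

lemma bij: "bij_betw h (carrier M) (carrier N)"
  by (rule bij_betwI[where g = k]) (use h_in k_in k_h h_k in auto)

lemma inj: "inj_on h (carrier M)" "inj_on k (carrier N)"
proof -
  show "inj_on h (carrier M)" by (rule inj_on_inverseI) (rule k_h)
  show "inj_on k (carrier N)" by (rule inj_on_inverseI) (rule h_k)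
qed

lemma coord_W: "coord (W x) u = (if u \<in> carrier N then coord x (k u) else 0)"
  by (simp add: W_def coord_composition_op inj)

lemma coord_W': "coord (W' y) a = (if a \<in> carrier M then coord y (h a) else 0)"
  by (simp add: W'_def coord_composition_op inj)

lemma W_fock: "W x \<in> fock N"
  by (simp add: fock_def coord_W)

lemma W'_fock: "W' y \<in> fock M"
  by (simp add: fock_def coord_W')

lemma W'_W: "x \<in> fock M \<Longrightarrow> W' (W x) = x"
  by (rule ell2_eqI) (auto simp: coord_W coord_W' h_in k_h fock_def)

lemma W_W': "y \<in> fock N \<Longrightarrow> W (W' y) = y"
  by (rule ell2_eqI) (auto simp: coord_W coord_W' k_in h_k fock_def)

lemma W_cscale: "W (cscale c x) = cscale c (W x)"
  by (rule ell2_eqI) (simp add: coord_W coord_cscale)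

lemma cinner_W: "cinner (W x) y = cinner x (W' y)"
  unfolding W_def W'_def by (rule cinner_composition_op[OF bij]) (rule k_h)

lemma conjugation_apply: "conjugation T y = W (T (W' y))"
  by (simp add: conjugation_def)

lemma conjugation_add: "conjugation (S + T) = conjugation S + conjugation T"
  by (rule blinfun_eqI) (simp add: conjugation_apply blinfun.add_left blinfun.add_right)

lemma conjugation_cscale: "conjugation (cscale_op c T) = cscale_op c (conjugation T)"
  by (rule blinfun_eqI) (simp add: conjugation_apply cscale_op_apply W_cscale)

text \<open>\<open>W' \<circ> W\<close> is the projection onto the Fock space, which contains the range of a left convolution.\<close>

lemma conjugation_compose:
  "left_convolution M T \<Longrightarrow> conjugation (S o\<^sub>L T) = conjugation S o\<^sub>L conjugation T"
  by (rule blinfun_eqI) (simp add: conjugation_apply W'_W M.left_convolution_fock)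

lemma norm_conjugation_le: "norm (conjugation T) \<le> norm T"
proof -
  have W: "norm W \<le> 1" "norm W' \<le> 1"
    by (simp_all add: W_def W'_def norm_composition_op inj)
  have "norm (conjugation T) \<le> norm (W o\<^sub>L T) * norm W'"
    unfolding conjugation_def by (rule norm_blinfun_compose)
  also have "\<dots> \<le> norm (W o\<^sub>L T) * 1" using W(2) by (intro mult_left_mono) auto
  also have "\<dots> \<le> norm W * norm T" by (simp add: norm_blinfun_compose)
  also have "\<dots> \<le> 1 * norm T" using W(1) by (intro mult_right_mono) auto
  finally show ?thesis by simp
qed

lemma conjugation_creation:
  assumes v: "v \<in> carrier M" shows "conjugation (creation M v) = creation N (h v)"
proof (rule blinfun_eqI, rule ell2_eqI)
  fix y u
  have injs: "inj_on (\<lambda>w. v \<otimes>\<^bsub>M\<^esub> w) (carrier M)" "inj_on (\<lambda>w. h v \<otimes>\<^bsub>N\<^esub> w) (carrier N)"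
    by (rule M.left_cancel[OF v]) (rule N.left_cancel[OF h_in[OF v]])
  show "coord (conjugation (creation M v) y) u = coord (creation N (h v) y) u"
  proof (cases "u \<in> (\<lambda>w. h v \<otimes>\<^bsub>N\<^esub> w) ` carrier N")
    case True
    then obtain w' where w': "w' \<in> carrier N" "u = h v \<otimes>\<^bsub>N\<^esub> w'" by blast
    define w where "w = k w'"
    have w: "w \<in> carrier M" "u = h v \<otimes>\<^bsub>N\<^esub> h w" using w' by (simp_all add: w_def k_in h_k)
    then have "u = h (v \<otimes>\<^bsub>M\<^esub> w)" using v by (simp add: h_mult)
    then have "u \<in> carrier N" "k u = v \<otimes>\<^bsub>M\<^esub> w" using v w by (simp_all add: h_in k_h)
    then show ?thesis
      unfolding conjugation_apply coord_W creation_coord[OF injs(1)] creation_coord[OF injs(2)]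
      using w v by (simp add: shift_def inv_into_f_f[OF injs(1)] inv_into_f_f[OF injs(2)] h_in coord_W')
  next
    case False
    have "k u \<notin> (\<lambda>w. v \<otimes>\<^bsub>M\<^esub> w) ` carrier M" if "u \<in> carrier N"
    proof
      assume "k u \<in> (\<lambda>w. v \<otimes>\<^bsub>M\<^esub> w) ` carrier M"
      then obtain w where "w \<in> carrier M" "k u = v \<otimes>\<^bsub>M\<^esub> w" by blast
      then have "u = h v \<otimes>\<^bsub>N\<^esub> h w" using h_k[OF that] h_mult[OF v, of w] by simp
      then show False using False h_in[OF \<open>w \<in> carrier M\<close>] by blast
    qed
    then show ?thesis
      unfolding conjugation_apply coord_W creation_coord[OF injs(1)] creation_coord[OF injs(2)]
      using False by (simp add: shift_def)
  qed
qed

lemma conjugation_generated_algebra: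
  assumes X: "coordinate_continuous X" and Y: "coordinate_continuous Y"
    and cont: "continuous_map X Y conjugation"
    and T: "T \<in> generated_algebra X M"
  shows "conjugation T \<in> generated_algebra Y N"
proof -
  let ?A = "generated_algebra X M" and ?B = "generated_algebra Y N"
  have A: "op_subalgebra ?A" "closedin X ?A" and B: "op_subalgebra ?B" "closedin Y ?B"
    using generated_algebra_closed[OF X] generated_algebra_closed[OF Y] by blast+
  define P where "P = {T \<in> ?A. conjugation T \<in> ?B}"
  have zero: "conjugation 0 = 0" by (rule blinfun_eqI) (simp add: conjugation_apply)
  have "?A \<subseteq> P"
  proof (rule generated_algebra_minimal[OF X])
    show "op_subalgebra P"
      using A(1) B(1) M.generated_algebra_left_convolution[OF X]
      by (auto simp: op_subalgebra_def P_def zero conjugation_add conjugation_compose conjugation_cscale)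
    have "closedin X {T \<in> topspace X. conjugation T \<in> ?B}"
      by (rule closedin_continuous_map_preimage[OF cont B(2)])
    then have "closedin X (?A \<inter> {T \<in> topspace X. conjugation T \<in> ?B})"
      using A(2) by (rule closedin_Int[rotated])
    moreover have "?A \<inter> {T \<in> topspace X. conjugation T \<in> ?B} = P"
      using X by (auto simp: P_def coordinate_continuous_def)
    ultimately show "closedin X P" by simp
    show "creation M v \<in> P" if "v \<in> carrier M" for v
      using that by (simp add: P_def conjugation_creation creation_in_generated_algebra X Y h_in)
  qed
  then show ?thesis using T by (auto simp: P_def)
qed

text \<open>For the weak operator topology, the adjoint moves \<open>W\<close> and \<open>W'\<close> onto the two vectors of a matrix
  coefficient, which then is a matrix coefficient of the argument.\<close>

lemma continuous_map_conjugation: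
  "continuous_map euclidean euclidean conjugation"
  "continuous_map weak_operator_topology weak_operator_topology conjugation"
proof -
  show "continuous_map euclidean euclidean conjugation"
    unfolding continuous_map_iff_continuous2
  proof (rule linear_continuous_on, rule bounded_linear_intro)
    show "conjugation (r *\<^sub>R T) = r *\<^sub>R conjugation T" for r T
      by (rule blinfun_eqI) (simp add: conjugation_apply blinfun.scaleR_left blinfun.scaleR_right)
    show "norm (conjugation T) \<le> norm T * 1" for T by (simp add: norm_conjugation_le)
  qed (rule conjugation_add)
  have "continuous_map weak_operator_topology (product_topology (\<lambda>_. euclidean) UNIV)
      ((\<lambda>T (x, y). cinner (blinfun_apply T x) y) \<circ> conjugation)"
    unfolding continuous_map_componentwise_UNIV
  proof
    fix p :: "'b ell2 \<times> 'b ell2"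
    have "(\<lambda>T. ((\<lambda>T (x, y). cinner (blinfun_apply T x) y) \<circ> conjugation) T p) =
        (\<lambda>T. cinner (blinfun_apply T (W' (fst p))) (W' (snd p)))"
      by (simp add: fun_eq_iff case_prod_unfold conjugation_apply cinner_W)
    then show "continuous_map weak_operator_topology euclidean
        (\<lambda>T. ((\<lambda>T (x, y). cinner (blinfun_apply T x) y) \<circ> conjugation) T p)"
      by (simp only: continuous_map_weak_operator_cinner)
  qed
  then have "continuous_map weak_operator_topology euclidean
      ((\<lambda>T (x, y). cinner (blinfun_apply T x) y) \<circ> conjugation)"
    by (simp only: euclidean_product_topology)
  then show "continuous_map weak_operator_topology weak_operator_topology conjugation"
    unfolding weak_operator_topology_def[where 'a = 'b] by (rule continuous_map_pullback') simp
qed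

end

context fock_transport
begin

interpretation inv: fock_transport N M k h by (rule inverse)

lemma inv_W: "inv.W = W'" "inv.W' = W"
  by (simp_all add: inv.W_def W'_def inv.W'_def W_def)

lemma conjugation_conjugation:
  assumes T: "left_convolution M T" shows "inv.conjugation (conjugation T) = T"
proof (rule blinfun_eqI)
  fix x
  have "T (W' (W x)) = T x"
  proof (rule ell2_eqI)
    show "coord (T (W' (W x))) u = coord (T x) u" for u
      unfolding left_convolutionD[OF T, of x] left_convolutionD[OF T, of "W' (W x)"]
      by (intro sum.cong HOL.refl) (auto simp: factorizations_def coord_W coord_W' h_in k_h)
  qed
  then show "inv.conjugation (conjugation T) x = T x"
    by (simp add: inv.conjugation_apply inv_W conjugation_apply W'_W M.left_convolution_fock[OF T])
qed

lemma A_alg_isometrically_isomorphic: "isometrically_isomorphic (A_alg M) (A_alg N)"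
  unfolding isometrically_isomorphic_def A_alg_eq
proof (intro exI[of _ conjugation] conjI ballI allI)
  note E = coordinate_continuous_euclidean
  note convM = M.generated_algebra_left_convolution[OF E] and convN = N.generated_algebra_left_convolution[OF E]
  show "bij_betw conjugation (generated_algebra euclidean M) (generated_algebra euclidean N)"
  proof (rule bij_betw_byWitness[where f' = inv.conjugation])
    show "conjugation ` generated_algebra euclidean M \<subseteq> generated_algebra euclidean N"
      using conjugation_generated_algebra[OF E E continuous_map_conjugation(1)] by blast
    show "inv.conjugation ` generated_algebra euclidean N \<subseteq> generated_algebra euclidean M"
      using inv.conjugation_generated_algebra[OF E E inv.continuous_map_conjugation(1)] by blast
    show "\<forall>T\<in>generated_algebra euclidean M. inv.conjugation (conjugation T) = T"
      using conjugation_conjugation convM by blast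
    show "\<forall>T\<in>generated_algebra euclidean N. conjugation (inv.conjugation T) = T"
    proof
      fix T assume "T \<in> generated_algebra euclidean N"
      then show "conjugation (inv.conjugation T) = T" using fock_transport.conjugation_conjugation[OF inverse convN] by simp
    qed
  qed
  fix S T assume S: "S \<in> generated_algebra euclidean M" and T: "T \<in> generated_algebra euclidean M"
  show "conjugation (S + T) = conjugation S + conjugation T" by (rule conjugation_add)
  show "conjugation (S o\<^sub>L T) = conjugation S o\<^sub>L conjugation T"
    by (rule conjugation_compose[OF convM[OF T]])
next
  fix c T show "conjugation (cscale_op c T) = cscale_op c (conjugation T)" by (rule conjugation_cscale)
next
  fix T assume "T \<in> generated_algebra euclidean M"
  then have "inv.conjugation (conjugation T) = T"
    using conjugation_conjugation M.generated_algebra_left_convolution[OF coordinate_continuous_euclidean] by blast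
  then show "norm (conjugation T) = norm T"
    using norm_conjugation_le[of T] inv.norm_conjugation_le[of "conjugation T"] by simp
qed

lemma fock_unitary_W: "fock_unitary M N W"
  unfolding fock_unitary_def
proof (intro conjI ballI allI)
  show "bij_betw W (fock M) (fock N)"
    by (rule bij_betw_byWitness[where f' = W']) (auto simp: W'_W W_W' W_fock W'_fock)
  show "W (x + y) = W x + W y" for x y by (simp add: blinfun.add_right)
  show "cinner (W x) (W y) = cinner x y" if "y \<in> fock M" for x y
    using that by (simp add: cinner_W W'_W)
  show "W (cscale c x) = cscale c (W x)" for c x by (rule W_cscale)
qed

lemma L_algs_unitarily_equivalent: "L_alg_unitarily_equivalent M N"
  unfolding L_alg_unitarily_equivalent_def L_alg_eq
proof (intro exI[of _ "blinfun_apply W"] conjI ballI fock_unitary_W)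
  note E = coordinate_continuous_weak_operator
  fix S assume "S \<in> generated_algebra weak_operator_topology M"
  then have "conjugation S \<in> generated_algebra weak_operator_topology N"
    by (rule conjugation_generated_algebra[OF E E continuous_map_conjugation(2)])
  moreover have "conjugation S (W x) = W (S x)" if "x \<in> fock M" for x
    using that by (simp add: conjugation_apply W'_W)
  ultimately show "\<exists>T\<in>generated_algebra weak_operator_topology N. \<forall>x\<in>fock M. T (W x) = W (S x)" by blast
next
  note E = coordinate_continuous_weak_operator
  fix T assume T: "T \<in> generated_algebra weak_operator_topology N"
  then have "inv.conjugation T \<in> generated_algebra weak_operator_topology M"
    by (rule inv.conjugation_generated_algebra[OF E E inv.continuous_map_conjugation(2)])
  moreover have "T (W x) = W (inv.conjugation T x)" for x
    using N.left_convolution_fock[OF N.generated_algebra_left_convolution[OF E T]]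
    by (simp add: inv.conjugation_apply inv_W W_W')
  ultimately show "\<exists>S\<in>generated_algebra weak_operator_topology M. \<forall>x\<in>fock M. T (W x) = W (S x)" by blast
qed

end

lemma is_iso_imp_equivalent_algebras:
  assumes "finitely_factorizable_monoid M" "finitely_factorizable_monoid N" "M \<cong> N"
  shows "isometrically_isomorphic (A_alg M) (A_alg N)" "L_alg_unitarily_equivalent M N"
proof -
  interpret M: finitely_factorizable_monoid M by (rule assms)
  interpret N: finitely_factorizable_monoid N by (rule assms)
  obtain h where h: "h \<in> hom M N" "bij_betw h (carrier M) (carrier N)"
    using assms(3) by (auto simp: is_iso_def iso_def)
  interpret fock_transport M N h "inv_into (carrier M) h"
  proof
    show "h a \<in> carrier N" if "a \<in> carrier M" for a using bij_betwE[OF h(2)] that by blast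
    show "inv_into (carrier M) h b \<in> carrier M" if "b \<in> carrier N" for b
      using bij_betwE[OF bij_betw_inv_into[OF h(2)]] that by blast
    show "inv_into (carrier M) h (h a) = a" if "a \<in> carrier M" for a
      by (rule bij_betw_inv_into_left[OF h(2) that])
    show "h (inv_into (carrier M) h b) = b" if "b \<in> carrier N" for b
      by (rule bij_betw_inv_into_right[OF h(2) that])
    show "h (a \<otimes>\<^bsub>M\<^esub> a') = h a \<otimes>\<^bsub>N\<^esub> h a'" if "a \<in> carrier M" "a' \<in> carrier M" for a a'
      by (rule hom_mult[OF h(1) that])
  qed
  show "isometrically_isomorphic (A_alg M) (A_alg N)" by (rule A_alg_isometrically_isomorphic)
  show "L_alg_unitarily_equivalent M N" by (rule L_algs_unitarily_equivalent)
qed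

section \<open>Conjugate permutations give isomorphic semigroups\<close>

fun relabel :: "(nat \<Rightarrow> nat) \<Rightarrow> edge \<Rightarrow> edge" where
  "relabel \<sigma> (Blue i) = Blue (\<sigma> i)"
| "relabel \<sigma> Red = Red"

lemma relabel_words:
  assumes "\<And>i. i \<in> {1..n} \<Longrightarrow> \<sigma> i \<in> {1..n}" "w \<in> words n"
  shows "map (relabel \<sigma>) w \<in> words n"
  using assms(2)
proof (induction w)
  case (Cons a w)
  then show ?case using assms(1) by (cases a) (auto simp del: atLeastAtMost_iff)
qed simp

lemma relabel_two_graph_rel:
  assumes \<sigma>: "\<And>i. i \<in> {1..n} \<Longrightarrow> \<sigma> i \<in> {1..n}"
    and eqv: "\<And>i. i \<in> {1..n} \<Longrightarrow> \<sigma> (\<tau>1 i) = \<tau>2 (\<sigma> i)"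
    and rel: "(u, v) \<in> two_graph_rel n \<tau>1"
  shows "(map (relabel \<sigma>) u, map (relabel \<sigma>) v) \<in> two_graph_rel n \<tau>2"
  using rel
proof induction
  case (commute i u v)
  then show ?case
    using two_graph_rel.commute[of "\<sigma> i" n "map (relabel \<sigma>) u" "map (relabel \<sigma>) v" \<tau>2]
      \<sigma>[of i] eqv[of i] relabel_words[of n \<sigma>, OF \<sigma>] by simp
next
  case (refl u)
  then show ?case using relabel_words[of n \<sigma>, OF \<sigma>] by (simp add: two_graph_rel.refl)
next
  case (sym u v)
  then show ?case by (simp add: two_graph_rel.sym)
next
  case (trans u v w)
  then show ?case by (metis two_graph_rel.trans)
qed

text \<open>If \<open>\<sigma>\<close> intertwines the permutations, then by \<open>relabel_two_graph_rel\<close> every representative of the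
  class gives the same result.\<close>

definition relabel_class :: "nat \<Rightarrow> (nat \<Rightarrow> nat) \<Rightarrow> (nat \<Rightarrow> nat) \<Rightarrow> edge list set \<Rightarrow> edge list set" where
  "relabel_class n \<tau>2 \<sigma> x = word_class n \<tau>2 (map (relabel \<sigma>) (SOME w. w \<in> x))"

lemma relabel_class_eq:
  assumes p1: "\<tau>1 permutes {1..n}" and p2: "\<tau>2 permutes {1..n}"
    and \<sigma>: "\<And>i. i \<in> {1..n} \<Longrightarrow> \<sigma> i \<in> {1..n}"
    and eqv: "\<And>i. i \<in> {1..n} \<Longrightarrow> \<sigma> (\<tau>1 i) = \<tau>2 (\<sigma> i)"
    and w: "w \<in> words n"
  shows "relabel_class n \<tau>2 \<sigma> (word_class n \<tau>1 w) = word_class n \<tau>2 (map (relabel \<sigma>) w)"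
proof -
  define v where "v = (SOME v. v \<in> word_class n \<tau>1 w)"
  have "w \<in> word_class n \<tau>1 w" using w by (simp add: word_class_def two_graph_rel.refl)
  then have "v \<in> word_class n \<tau>1 w" unfolding v_def by (rule someI)
  then have "(w, v) \<in> two_graph_rel n \<tau>1" by (simp add: word_class_def)
  then have "(map (relabel \<sigma>) w, map (relabel \<sigma>) v) \<in> two_graph_rel n \<tau>2"
    by (intro relabel_two_graph_rel[where \<sigma> = \<sigma> and ?\<tau>1.0 = \<tau>1 and ?\<tau>2.0 = \<tau>2] \<sigma> eqv)
  then show ?thesis
    unfolding relabel_class_def v_def[symmetric] unfolding word_class_def
    by (rule equiv_class_eq[OF equiv_two_graph_rel[OF p2], symmetric])
qed

lemma conjugate_imp_is_iso:
  assumes p1: "\<tau>1 permutes {1..n}" and p2: "\<tau>2 permutes {1..n}"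
    and \<sigma>: "bij_betw \<sigma> {1..n} {1..n}"
    and eqv: "\<And>i. i \<in> {1..n} \<Longrightarrow> \<sigma> (\<tau>1 i) = \<tau>2 (\<sigma> i)"
  shows "two_graph n \<tau>1 \<cong> two_graph n \<tau>2"
proof -
  define \<rho> where "\<rho> = inv_into {1..n} \<sigma>"
  have \<sigma>_in: "\<sigma> i \<in> {1..n}" and \<rho>_in: "\<rho> i \<in> {1..n}" and \<rho>\<sigma>: "\<rho> (\<sigma> i) = i" and \<sigma>\<rho>: "\<sigma> (\<rho> i) = i"
    if "i \<in> {1..n}" for i
    using that bij_betwE[OF \<sigma>] bij_betwE[OF bij_betw_inv_into[OF \<sigma>]]
      bij_betw_inv_into_left[OF \<sigma>] bij_betw_inv_into_right[OF \<sigma>] unfolding \<rho>_def by blast+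
  have eqv': "\<rho> (\<tau>2 i) = \<tau>1 (\<rho> i)" if i: "i \<in> {1..n}" for i
  proof -
    have "\<sigma> (\<tau>1 (\<rho> i)) = \<tau>2 i" using eqv[OF \<rho>_in[OF i]] \<sigma>\<rho>[OF i] by simp
    then show ?thesis using \<rho>\<sigma>[OF perm_in[OF p1 \<rho>_in[OF i]]] by metis
  qed
  have inv: "map (relabel \<rho>) (map (relabel \<sigma>) w) = w" "map (relabel \<sigma>) (map (relabel \<rho>) w) = w"
    if "w \<in> words n" for w
    using that
  proof (induction w)
    case (Cons a w)
    { case 1 then show ?case using Cons \<rho>\<sigma> by (cases a) auto }
    { case 2 then show ?case using Cons \<sigma>\<rho> by (cases a) auto }
  qed simp_all
  let ?h = "relabel_class n \<tau>2 \<sigma>" and ?k = "relabel_class n \<tau>1 \<rho>"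
  have h: "?h (word_class n \<tau>1 w) = word_class n \<tau>2 (map (relabel \<sigma>) w)" if "w \<in> words n" for w
    by (rule relabel_class_eq[OF p1 p2]) (fact \<sigma>_in eqv that)+
  have k: "?k (word_class n \<tau>2 w) = word_class n \<tau>1 (map (relabel \<rho>) w)" if "w \<in> words n" for w
    by (rule relabel_class_eq[OF p2 p1]) (fact \<rho>_in eqv' that)+
  have wh: "map (relabel \<sigma>) w \<in> words n" and wk: "map (relabel \<rho>) w \<in> words n" if "w \<in> words n" for w
    by (rule relabel_words[OF _ that], erule \<sigma>_in) (rule relabel_words[OF _ that], erule \<rho>_in)
  have "?h \<in> hom (two_graph n \<tau>1) (two_graph n \<tau>2)"
  proof (rule homI)
    fix x y assume x: "x \<in> carrier (two_graph n \<tau>1)" and y: "y \<in> carrier (two_graph n \<tau>1)"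
    obtain u where u: "u \<in> words n" "x = word_class n \<tau>1 u" using x by (rule word_classE[OF p1])
    obtain v where v: "v \<in> words n" "y = word_class n \<tau>1 v" using y by (rule word_classE[OF p1])
    show "?h x \<in> carrier (two_graph n \<tau>2)" unfolding u(2) h[OF u(1)] by (rule word_class_carrier[OF p2 wh[OF u(1)]])
    show "?h (x \<otimes>\<^bsub>two_graph n \<tau>1\<^esub> y) = ?h x \<otimes>\<^bsub>two_graph n \<tau>2\<^esub> ?h y"
      using u v wh by (simp add: h word_class_mult[OF p1] word_class_mult[OF p2])
  qed
  moreover have "bij_betw ?h (carrier (two_graph n \<tau>1)) (carrier (two_graph n \<tau>2))"
  proof (rule bij_betw_byWitness[where f' = ?k])
    show "\<forall>x\<in>carrier (two_graph n \<tau>1). ?k (?h x) = x"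
    proof
      fix x assume "x \<in> carrier (two_graph n \<tau>1)"
      then obtain u where "u \<in> words n" "x = word_class n \<tau>1 u" by (rule word_classE[OF p1])
      then show "?k (?h x) = x" using wh[of u] inv(1)[of u] h[of u] k[of "map (relabel \<sigma>) u"] by simp
    qed
    show "\<forall>x\<in>carrier (two_graph n \<tau>2). ?h (?k x) = x"
    proof
      fix x assume "x \<in> carrier (two_graph n \<tau>2)"
      then obtain u where "u \<in> words n" "x = word_class n \<tau>2 u" by (rule word_classE[OF p2])
      then show "?h (?k x) = x" using wk[of u] inv(2)[of u] k[of u] h[of "map (relabel \<rho>) u"] by simp
    qed
    show "?h ` carrier (two_graph n \<tau>1) \<subseteq> carrier (two_graph n \<tau>2)"
      using \<open>?h \<in> hom _ _\<close> by (auto simp: hom_def)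
    show "?k ` carrier (two_graph n \<tau>2) \<subseteq> carrier (two_graph n \<tau>1)"
    proof clarify
      fix x assume "x \<in> carrier (two_graph n \<tau>2)"
      then obtain u where "u \<in> words n" "x = word_class n \<tau>2 u" by (rule word_classE[OF p2])
      then show "?k x \<in> carrier (two_graph n \<tau>1)" using wk[of u] k[of u] word_class_carrier[OF p1] by simp
    qed
  qed
  ultimately show ?thesis by (auto simp: is_iso_def iso_def)
qed

lemma coefficient_homomorphisms_imp_is_iso:
  assumes g: "coefficient_homomorphism n1 n2 \<tau>1 \<tau>2 X g" and g': "coefficient_homomorphism n2 n1 \<tau>2 \<tau>1 X' g'"
  shows "two_graph n1 \<tau>1 \<cong> two_graph n2 \<tau>2"
proof -
  have p: "\<tau>1 permutes {1..n1}" "\<tau>2 permutes {1..n2}"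
    by (rule coefficient_homomorphism.perm1[OF g], rule coefficient_homomorphism.perm2[OF g])
  have n: "n1 = n2"
    using coefficient_homomorphism.rank_le[OF g] coefficient_homomorphism.rank_le[OF g'] by simp
  show ?thesis
  proof (cases "2 \<le> n1")
    case True
    obtain \<sigma> where "bij_betw \<sigma> {1..n1} {1..n1}" "\<And>i. i \<in> {1..n1} \<Longrightarrow> \<sigma> (\<tau>1 i) = \<tau>2 (\<sigma> i)"
      using coefficient_homomorphism.conjugate[OF g HOL.refl n[symmetric] True] by blast
    then show ?thesis using conjugate_imp_is_iso[of \<tau>1 n1 \<tau>2 \<sigma>] p n by blast
  next
    case False
    then have "{1..n1} = {} \<or> {1..n1} = {1}" by auto
    then have "\<tau>1 = id" "\<tau>2 = id" using p n by (auto simp: permutes_sing)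
    then show ?thesis using n conjugate_imp_is_iso[of \<tau>1 n1 \<tau>2 id] p by simp
  qed
qed

theorem theorem8p3:
  fixes n1 n2 :: nat and \<tau>1 \<tau>2 :: "nat \<Rightarrow> nat"
  assumes "\<tau>1 permutes {1..n1}" and "\<tau>2 permutes {1..n2}"
  shows "(two_graph n1 \<tau>1 \<cong> two_graph n2 \<tau>2 \<longleftrightarrow>
      isometrically_isomorphic (A_alg (two_graph n1 \<tau>1)) (A_alg (two_graph n2 \<tau>2))) \<and>
    (isometrically_isomorphic (A_alg (two_graph n1 \<tau>1)) (A_alg (two_graph n2 \<tau>2)) \<longleftrightarrow>
      L_alg_unitarily_equivalent (two_graph n1 \<tau>1) (two_graph n2 \<tau>2))"
proof -
  let ?M = "two_graph n1 \<tau>1" and ?N = "two_graph n2 \<tau>2"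
  note M = finitely_factorizable_two_graph[OF assms(1)] and N = finitely_factorizable_two_graph[OF assms(2)]
  have "?M \<cong> ?N" if A: "isometrically_isomorphic (A_alg ?M) (A_alg ?N)"
  proof -
    have "op_subalgebra (A_alg ?M)"
      unfolding A_alg_eq by (rule generated_algebra_closed(1)[OF coordinate_continuous_euclidean])
    then have "isometrically_isomorphic (A_alg ?N) (A_alg ?M)" by (rule isometrically_isomorphic_sym[OF A])
    then show ?thesis
      using A_algs_coefficient_homomorphism[OF assms(1,2)] A_algs_coefficient_homomorphism[OF assms(2,1)] A
        coefficient_homomorphisms_imp_is_iso by blast
  qed
  moreover have "?M \<cong> ?N" if L: "L_alg_unitarily_equivalent ?M ?N"
  proof -
    have "S x \<in> fock ?M" if "S \<in> L_alg ?M" for S x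
      using finitely_factorizable_monoid.left_convolution_fock[OF M
          finitely_factorizable_monoid.generated_algebra_left_convolution[OF M
            coordinate_continuous_weak_operator]] that
      unfolding L_alg_eq by blast
    then have "L_alg_unitarily_equivalent ?N ?M" by (rule L_alg_unitarily_equivalent_sym[OF L])
    then show ?thesis
      using L_algs_coefficient_homomorphism[OF assms(1,2) L] L_algs_coefficient_homomorphism[OF assms(2,1)]
        coefficient_homomorphisms_imp_is_iso by blast
  qed
  ultimately show ?thesis using is_iso_imp_equivalent_algebras[OF M N] by blast
qed

end
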